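(* Let $G$ be a connected, simply connected, non-abelian nilpotent Lie group of dimension $4$ and let $\Gamma\backslash G$ be a nilmanifold, with $\Gamma\subset G$ a discrete subgroup. Then for every left-invariant Riemannian metric, $\Gamma\backslash G$ has no nonzero left-invariant harmonic spinor.
   Context: Clifford convention: $v\cdot v=-|v|^2$. For a left-invariant metric $g$ with left-invariant orthonormal frame $(e_1,\dots,e_n)$, fix an irreducible real representation $\rho:\mathrm{Cl}_n\to\mathrm{End}(W)$. With the trivial spin structure on $\Gamma\backslash G$ (the quotient of $G\times\mathrm{Spin}(n)$ by $y\cdot(x,\tilde h)=(yx,\tilde h)$), spinors are $\Gamma$-invariant maps $\phi:G\to W$; left-invariant spinors are the constant ones. The Dirac operator is $D\phi=\sum_ie_i\nabla_{e_i}\phi$ with $\nabla_X\phi=d_X\phi+\frac12\sum_{j<k}g(\overline\nabla_Xe_j,e_k)e_je_k\phi$, $\overline\nabla$ the Levi-Civita connection. A spinor is harmonic if $D\phi=0$. *)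

theory Defs
  imports "HOL-Analysis.Analysis" "HOL-Algebra.Generated_Groups"
begin

section \<open>Smooth manifolds\<close>

text \<open>For open \<open>S\<close>: all iterated directional derivatives of order at most \<open>k\<close> exist as Frechet
  derivatives and are continuous, which in finite dimension is the class C^k.\<close>

fun Ck_on :: "nat \<Rightarrow> 'a::real_normed_vector set \<Rightarrow> ('a \<Rightarrow> 'b::real_normed_vector) \<Rightarrow> bool" where
  "Ck_on 0 S f \<longleftrightarrow> continuous_on S f"
| "Ck_on (Suc k) S f \<longleftrightarrow>
     (\<forall>x\<in>S. f differentiable (at x)) \<and> (\<forall>v. Ck_on k S (\<lambda>x. frechet_derivative f (at x) v))"

definition smooth_on :: "'a::real_normed_vector set \<Rightarrow> ('a \<Rightarrow> 'b::real_normed_vector) \<Rightarrow> bool" where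
  "smooth_on S f \<longleftrightarrow> open S \<and> (\<forall>k. Ck_on k S f)"

text \<open>A chart is a pair \<open>(U, c)\<close>; only the values of \<open>c\<close> on \<open>U\<close> matter.\<close>

type_synonym ('g, 'e) atlas = "('g set \<times> ('g \<Rightarrow> 'e)) set"

definition smooth_atlas ::
  "('g::topological_space, 'e::real_normed_vector) atlas \<Rightarrow> bool" where
  "smooth_atlas A \<longleftrightarrow>
     \<Union> (fst ` A) = UNIV \<and>
     (\<forall>(U, c)\<in>A. open U \<and> open (c ` U) \<and> homeomorphism U (c ` U) c (inv_into U c)) \<and>
     (\<forall>(U, c)\<in>A. \<forall>(V, d)\<in>A. smooth_on (c ` (U \<inter> V)) (d \<circ> inv_into U c))"

definition prod_atlas ::
  "('g, 'e) atlas \<Rightarrow> ('h, 'f) atlas \<Rightarrow> ('g \<times> 'h, 'e \<times> 'f) atlas" where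
  "prod_atlas A B = {(U \<times> V, map_prod c d) | U c V d. (U, c) \<in> A \<and> (V, d) \<in> B}"

definition smooth_map ::
  "('g::topological_space, 'e::real_normed_vector) atlas \<Rightarrow>
   ('h::topological_space, 'f::real_normed_vector) atlas \<Rightarrow> ('g \<Rightarrow> 'h) \<Rightarrow> bool" where
  "smooth_map A B F \<longleftrightarrow>
     continuous_on UNIV F \<and>
     (\<forall>(U, c)\<in>A. \<forall>(V, d)\<in>B. smooth_on (c ` (U \<inter> F -` V)) (d \<circ> F \<circ> inv_into U c))"

text \<open>Smoothness on a neighbourhood of a point, for functions with values in a vector space.\<close>

definition smooth_near ::
  "('g::topological_space, 'e::real_normed_vector) atlas \<Rightarrow> 'g \<Rightarrow>
   ('g \<Rightarrow> 'w::real_normed_vector) \<Rightarrow> bool" where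
  "smooth_near A p f \<longleftrightarrow>
     (\<exists>(U, c)\<in>A. \<exists>N. open N \<and> p \<in> N \<and> N \<subseteq> U \<and> smooth_on (c ` N) (f \<circ> inv_into U c))"

definition smooth_fun ::
  "('g::topological_space, 'e::real_normed_vector) atlas \<Rightarrow>
   ('g \<Rightarrow> 'w::real_normed_vector) \<Rightarrow> bool" where
  "smooth_fun A f \<longleftrightarrow> (\<forall>p. smooth_near A p f)"


section \<open>Tangent vectors and vector fields\<close>

text \<open>A tangent vector at \<open>p\<close> is the operator \<open>\<Sum>i. u\<^sub>i \<partial>/\<partial>x\<^sub>i\<close> at \<open>p\<close>, in some chart, acting on the
  real functions that are smooth near \<open>p\<close>.  The value 0 on all other functions makes operators that
  represent the same tangent vector equal.  The vector space operations are pointwise.\<close>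

type_synonym 'g tangent = "('g \<Rightarrow> real) \<Rightarrow> real"
type_synonym 'g vfield = "'g \<Rightarrow> 'g tangent"

definition tangent_space ::
  "('g::topological_space, 'e::real_normed_vector) atlas \<Rightarrow> 'g \<Rightarrow> 'g tangent set" where
  "tangent_space A p =
     {v. \<exists>(U, c)\<in>A. p \<in> U \<and> (\<exists>u. \<forall>f. v f =
        (if smooth_near A p f then frechet_derivative (f \<circ> inv_into U c) (at (c p)) u else 0))}"

definition smooth_vfield ::
  "('g::topological_space, 'e::real_normed_vector) atlas \<Rightarrow> 'g vfield \<Rightarrow> bool" where
  "smooth_vfield A X \<longleftrightarrow>
     (\<forall>p. X p \<in> tangent_space A p) \<and>
     (\<forall>p f. smooth_near A p f \<longrightarrow> smooth_near A p (\<lambda>q. X q f))"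

definition lie_bracket ::
  "('g::topological_space, 'e::real_normed_vector) atlas \<Rightarrow> 'g vfield \<Rightarrow> 'g vfield \<Rightarrow> 'g vfield" where
  "lie_bracket A X Y =
     (\<lambda>p f. if smooth_near A p f then X p (\<lambda>q. Y q f) - Y p (\<lambda>q. X q f) else 0)"

text \<open>The derivative of a vector-valued function along a tangent vector, componentwise.\<close>

definition dir_deriv :: "'g tangent \<Rightarrow> ('g \<Rightarrow> 'w::euclidean_space) \<Rightarrow> 'w" where
  "dir_deriv v \<phi> = (\<Sum>b\<in>Basis. v (\<lambda>q. \<phi> q \<bullet> b) *\<^sub>R b)"


section \<open>Riemannian metrics and the Levi-Civita connection\<close>

definition riemannian_metric ::
  "('g::topological_space, 'e::real_normed_vector) atlas \<Rightarrow>
   ('g \<Rightarrow> 'g tangent \<Rightarrow> 'g tangent \<Rightarrow> real) \<Rightarrow> bool" where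
  "riemannian_metric A g \<longleftrightarrow>
     (\<forall>p. \<forall>u\<in>tangent_space A p. \<forall>v\<in>tangent_space A p. \<forall>w\<in>tangent_space A p. \<forall>a b.
        g p (\<lambda>f. a * u f + b * v f) w = a * g p u w + b * g p v w) \<and>
     (\<forall>p. \<forall>v\<in>tangent_space A p. \<forall>w\<in>tangent_space A p. g p v w = g p w v) \<and>
     (\<forall>p. \<forall>v\<in>tangent_space A p. v \<noteq> (\<lambda>f. 0) \<longrightarrow> g p v v > 0) \<and>
     (\<forall>X Y. smooth_vfield A X \<and> smooth_vfield A Y \<longrightarrow> smooth_fun A (\<lambda>p. g p (X p) (Y p)))"

definition affine_connection ::
  "('g::topological_space, 'e::real_normed_vector) atlas \<Rightarrow>
   ('g vfield \<Rightarrow> 'g vfield \<Rightarrow> 'g vfield) \<Rightarrow> bool" where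
  "affine_connection A nabla \<longleftrightarrow>
     (\<forall>X Y. smooth_vfield A X \<and> smooth_vfield A Y \<longrightarrow> smooth_vfield A (nabla X Y)) \<and>
     (\<forall>X X' Y h h'. smooth_vfield A X \<and> smooth_vfield A X' \<and> smooth_vfield A Y \<and>
        smooth_fun A h \<and> smooth_fun A h' \<longrightarrow>
        nabla (\<lambda>p f. h p * X p f + h' p * X' p f) Y
          = (\<lambda>p f. h p * nabla X Y p f + h' p * nabla X' Y p f)) \<and>
     (\<forall>X Y Y'. smooth_vfield A X \<and> smooth_vfield A Y \<and> smooth_vfield A Y' \<longrightarrow>
        nabla X (\<lambda>p f. Y p f + Y' p f) = (\<lambda>p f. nabla X Y p f + nabla X Y' p f)) \<and>
     (\<forall>X Y h. smooth_vfield A X \<and> smooth_vfield A Y \<and> smooth_fun A h \<longrightarrow>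
        nabla X (\<lambda>p f. h p * Y p f) = (\<lambda>p f. X p h * Y p f + h p * nabla X Y p f))"

definition levi_civita_connection ::
  "('g::topological_space, 'e::real_normed_vector) atlas \<Rightarrow>
   ('g \<Rightarrow> 'g tangent \<Rightarrow> 'g tangent \<Rightarrow> real) \<Rightarrow> ('g vfield \<Rightarrow> 'g vfield \<Rightarrow> 'g vfield) \<Rightarrow> bool" where
  "levi_civita_connection A g nabla \<longleftrightarrow>
     affine_connection A nabla \<and>
     (\<forall>X Y. smooth_vfield A X \<and> smooth_vfield A Y \<longrightarrow>
        (\<lambda>p f. nabla X Y p f - nabla Y X p f) = lie_bracket A X Y) \<and>
     (\<forall>X Y Z p. smooth_vfield A X \<and> smooth_vfield A Y \<and> smooth_vfield A Z \<longrightarrow>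
        X p (\<lambda>q. g q (Y q) (Z q)) = g p (nabla X Y p) (Z p) + g p (Y p) (nabla X Z p))"


section \<open>Lie groups\<close>

definition lie_group ::
  "('g::{t2_space, second_countable_topology}) monoid \<Rightarrow>
   ('g, 'e::real_normed_vector) atlas \<Rightarrow> bool" where
  "lie_group G A \<longleftrightarrow>
     group G \<and> carrier G = UNIV \<and> smooth_atlas A \<and>
     smooth_map (prod_atlas A A) A (\<lambda>(x, y). x \<otimes>\<^bsub>G\<^esub> y) \<and>
     smooth_map A A (\<lambda>x. inv\<^bsub>G\<^esub> x)"

fun lower_central_series :: "'g monoid \<Rightarrow> nat \<Rightarrow> 'g set" where
  "lower_central_series G 0 = carrier G"
| "lower_central_series G (Suc k) =
     generate G {x \<otimes>\<^bsub>G\<^esub> y \<otimes>\<^bsub>G\<^esub> inv\<^bsub>G\<^esub> x \<otimes>\<^bsub>G\<^esub> inv\<^bsub>G\<^esub> y | x y.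
       x \<in> carrier G \<and> y \<in> lower_central_series G k}"

definition nilpotent_group :: "'g monoid \<Rightarrow> bool" where
  "nilpotent_group G \<longleftrightarrow> group G \<and> (\<exists>k. lower_central_series G k = {\<one>\<^bsub>G\<^esub>})"

text \<open>Push-forward of tangent vectors under the left translation by \<open>a\<close>.\<close>

definition push_left :: "'g monoid \<Rightarrow> 'g \<Rightarrow> 'g tangent \<Rightarrow> 'g tangent" where
  "push_left G a v = (\<lambda>f. v (\<lambda>x. f (a \<otimes>\<^bsub>G\<^esub> x)))"

definition left_invariant_vfield :: "'g monoid \<Rightarrow> 'g vfield \<Rightarrow> bool" where
  "left_invariant_vfield G X \<longleftrightarrow> (\<forall>a p. X (a \<otimes>\<^bsub>G\<^esub> p) = push_left G a (X p))"

definition left_invariant_metric ::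
  "'g monoid \<Rightarrow> ('g::topological_space, 'e::real_normed_vector) atlas \<Rightarrow>
   ('g \<Rightarrow> 'g tangent \<Rightarrow> 'g tangent \<Rightarrow> real) \<Rightarrow> bool" where
  "left_invariant_metric G A g \<longleftrightarrow>
     (\<forall>a p. \<forall>v\<in>tangent_space A p. \<forall>w\<in>tangent_space A p.
        g (a \<otimes>\<^bsub>G\<^esub> p) (push_left G a v) (push_left G a w) = g p v w)"

text \<open>The number of fields equals the dimension of the model space \<open>real ^ 'n\<close>, so an orthonormal
  family is automatically a basis at every point.\<close>

definition left_invariant_orthonormal_frame ::
  "('g::topological_space) monoid \<Rightarrow> ('g, real ^ 'n) atlas \<Rightarrow>
   ('g \<Rightarrow> 'g tangent \<Rightarrow> 'g tangent \<Rightarrow> real) \<Rightarrow> ('n::finite \<Rightarrow> 'g vfield) \<Rightarrow> bool" where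
  "left_invariant_orthonormal_frame G A g e \<longleftrightarrow>
     (\<forall>i. smooth_vfield A (e i) \<and> left_invariant_vfield G (e i)) \<and>
     (\<forall>i j p. g p (e i p) (e j p) = (if i = j then 1 else 0))"


section \<open>Clifford algebras and their representations\<close>

text \<open>The Clifford algebra of \<open>real ^ 'n\<close> has the basis \<open>e\<^sub>S\<close>, the product of the \<open>e\<^sub>i\<close>, \<open>i \<in> S\<close>, in
  increasing order.  To form \<open>e\<^sub>S e\<^sub>T\<close>, every pair \<open>s \<in> S\<close>, \<open>t \<in> T\<close> with \<open>t < s\<close> costs a sign for
  the transposition and every common index costs a sign because \<open>e\<^sub>i e\<^sub>i = -1\<close>.\<close>

type_synonym 'n clifford = "real ^ ('n set)"

definition cl_sign :: "'n::{finite, linorder} set \<Rightarrow> 'n set \<Rightarrow> real" where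
  "cl_sign S T = (- 1) ^ card {(s, t). s \<in> S \<and> t \<in> T \<and> t \<le> s}"

definition cl_mult :: "'n::{finite, linorder} clifford \<Rightarrow> 'n clifford \<Rightarrow> 'n clifford" where
  "cl_mult a b =
     (\<Sum>S\<in>UNIV. \<Sum>T\<in>UNIV. (cl_sign S T * (a $ S) * (b $ T)) *\<^sub>R axis (sym_diff S T) 1)"

definition cl_one :: "'n::finite clifford" where
  "cl_one = axis {} 1"

definition cl_gen :: "'n::finite \<Rightarrow> 'n clifford" where
  "cl_gen i = axis {i} 1"

definition cl_vec :: "real ^ 'n \<Rightarrow> 'n::finite clifford" where
  "cl_vec v = (\<Sum>i\<in>UNIV. (v $ i) *\<^sub>R cl_gen i)"

text \<open>The product is associative with unit \<open>cl_one\<close>, and \<open>v v = - |v|^2\<close>.\<close>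

lemma cl_mult_basis:
  "cl_mult (axis S 1) (axis T 1) = cl_sign S T *\<^sub>R (axis (sym_diff S T) 1 :: 'n::{finite,linorder} clifford)"
proof -
  have "(cl_sign S' T' * (axis S 1 $ S') * (axis T 1 $ T')) *\<^sub>R (axis (sym_diff S' T') 1 :: 'n clifford)
    = (if S' = S then if T' = T then cl_sign S T *\<^sub>R axis (sym_diff S T) 1 else 0 else 0)" for S' T'
    by (auto simp: axis_def)
  moreover have "(\<Sum>S'\<in>UNIV. \<Sum>T'\<in>UNIV. if S' = S then if T' = T then cl_sign S T *\<^sub>R axis (sym_diff S T) 1 else 0 else 0)
      = (cl_sign S T *\<^sub>R axis (sym_diff S T) 1 :: 'n clifford)" 
    by (subst sum.swap) (simp add: sum.delta)
  ultimately show ?thesis unfolding cl_mult_def by simp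
qed

lemma bilinear_cl_mult: "bilinear (cl_mult :: 'n::{finite, linorder} clifford \<Rightarrow> _)"
  unfolding bilinear_def linear_iff cl_mult_def
  by (simp add: sum.distrib scaleR_sum_right algebra_simps)

lemmas cl_mult_scaleR =
  bilinear_lmul[OF bilinear_cl_mult] bilinear_rmul[OF bilinear_cl_mult]

lemma cl_mult_sum:
  "cl_mult (sum f I) b = (\<Sum>i\<in>I. cl_mult (f i) b)" "cl_mult a (sum f I) = (\<Sum>i\<in>I. cl_mult a (f i))"
  using bilinear_cl_mult linear_sum[of "\<lambda>x. cl_mult x b"] linear_sum[of "cl_mult a"]
  unfolding bilinear_def by blast+

lemma cl_sign_eq_prod: "cl_sign S T = (\<Prod>s\<in>UNIV. \<Prod>t\<in>UNIV. if s \<in> S \<and> t \<in> T \<and> t \<le> s then -1 else 1)"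
  for S T :: "'n::{finite,linorder} set"
proof -
  have "(\<Prod>s\<in>UNIV. \<Prod>t\<in>UNIV. if s \<in> S \<and> t \<in> T \<and> t \<le> s then -1 else (1::real))
    = (\<Prod>p\<in>UNIV. if p \<in> {(s, t). s \<in> S \<and> t \<in> T \<and> t \<le> s} then -1 else 1)"
    by (simp add: prod.cartesian_product case_prod_unfold)
  also have "\<dots> = (-1) ^ card {(s, t). s \<in> S \<and> t \<in> T \<and> t \<le> s}"
    by (subst prod.If_cases) auto
  finally show ?thesis unfolding cl_sign_def by simp
qed

lemma cl_sign_left: "cl_sign (sym_diff S T) U = cl_sign S U * cl_sign T U"
  unfolding cl_sign_eq_prod by (simp flip: prod.distrib) (intro prod.cong refl, auto)
lemma cl_sign_right: "cl_sign U (sym_diff S T) = cl_sign U S * cl_sign U T"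
  unfolding cl_sign_eq_prod by (simp flip: prod.distrib) (intro prod.cong refl, auto)

lemma cl_mult_basis_assoc:
  "cl_mult (cl_mult (axis S 1) (axis T 1)) (axis U 1)
   = cl_mult (axis S 1) (cl_mult (axis T 1) (axis U 1) :: 'n::{finite,linorder} clifford)"
proof -
  have "sym_diff (sym_diff S T) U = sym_diff S (sym_diff T U)" by auto
  then show ?thesis
    by (simp add: cl_mult_basis cl_mult_scaleR cl_sign_left cl_sign_right)
qed

lemma cl_mult_assoc:
  "cl_mult (cl_mult a b) c = cl_mult a (cl_mult b c :: 'n::{finite, linorder} clifford)"
proof -
  have ex: "x = (\<Sum>S\<in>UNIV. (x $ S) *\<^sub>R axis S 1)" for x :: "'n clifford"
    using basis_expansion[of x] by (simp add: scalar_mult_eq_scaleR)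
  show ?thesis
    by (subst (1 2) ex[of a], subst (1 2) ex[of b], subst (1 2) ex[of c])
      (simp only: cl_mult_sum cl_mult_scaleR cl_mult_basis_assoc)
qed

lemma cl_mult_one: "cl_mult cl_one a = a" "cl_mult a cl_one = (a :: 'n::{finite, linorder} clifford)"
proof -
  have ex: "x = (\<Sum>S\<in>UNIV. (x $ S) *\<^sub>R axis S 1)" for x :: "'n clifford"
    using basis_expansion[of x] by (simp add: scalar_mult_eq_scaleR)
  have [simp]: "cl_sign {} S = 1" "cl_sign S {} = 1" for S :: "'n set"
    by (simp_all add: cl_sign_def)
  show "cl_mult cl_one a = a" "cl_mult a cl_one = a"
    by (subst (1 2) ex[of a], simp add: cl_mult_sum cl_mult_scaleR cl_mult_basis cl_one_def)+
qed

lemma cl_vec_square: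
  fixes v :: "real ^ 'n::{finite, linorder}"
  shows "cl_mult (cl_vec v) (cl_vec v) = - ((norm v)\<^sup>2) *\<^sub>R cl_one"
proof -
  have sg: "cl_sign {i} {j} = (if j \<le> i then -1 else 1)" for i j :: 'n
  proof -
    have "{(s, t). s \<in> {i} \<and> t \<in> {j} \<and> t \<le> s} = (if j \<le> i then {(i, j)} else {})" by auto
    then show ?thesis unfolding cl_sign_def by simp
  qed
  have anti: "cl_mult (cl_gen i) (cl_gen j) + cl_mult (cl_gen j) (cl_gen i)
     = (if i = j then -2 else 0) *\<^sub>R (cl_one :: 'n clifford)" for i j :: 'n
    unfolding cl_gen_def cl_mult_basis sg cl_one_def
    by (auto simp: Un_commute scaleR_2 simp flip: scaleR_left.add)
  let ?a = "\<lambda>i j. (v $ i * v $ j) *\<^sub>R cl_mult (cl_gen i) (cl_gen j :: 'n clifford)"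
  have ex: "cl_mult (cl_vec v) (cl_vec v) = (\<Sum>i\<in>UNIV. \<Sum>j\<in>UNIV. ?a i j)"
    unfolding cl_vec_def
    by (subst sum.swap) (simp add: cl_mult_sum cl_mult_scaleR scaleR_sum_right mult.commute)
  have "2 *\<^sub>R cl_mult (cl_vec v) (cl_vec v) = (\<Sum>i\<in>UNIV. \<Sum>j\<in>UNIV. ?a i j) + (\<Sum>i\<in>UNIV. \<Sum>j\<in>UNIV. ?a j i)"
    unfolding ex scaleR_2 by (subst sum.swap) simp
  also have "\<dots> = (\<Sum>i\<in>UNIV. \<Sum>j\<in>UNIV. (v $ i * v $ j) *\<^sub>R 
      (cl_mult (cl_gen i) (cl_gen j) + cl_mult (cl_gen j) (cl_gen i)))"
    by (simp add: sum.distrib scaleR_add_right mult.commute)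
  also have "\<dots> = (\<Sum>i\<in>UNIV. \<Sum>j\<in>UNIV. (if i = j then - 2 * (v $ i * v $ i) else 0) *\<^sub>R cl_one)"
    unfolding anti by (intro sum.cong refl) auto
  also have "\<dots> = (\<Sum>i\<in>UNIV. (- 2 * (v $ i * v $ i)))*\<^sub>R cl_one"
    by (simp add: scaleR_sum_left if_distrib[of "\<lambda>r. r *\<^sub>R cl_one"] cong: if_cong)
  also have "(\<Sum>i\<in>UNIV. (- 2 * (v $ i * v $ i))) = - 2 * (norm v)\<^sup>2"
    unfolding power2_norm_eq_inner inner_vec_def by (simp add: sum_distrib_left flip: sum_negf)
  finally have "2 *\<^sub>R cl_mult (cl_vec v) (cl_vec v) = 2 *\<^sub>R (- ((norm v)\<^sup>2) *\<^sub>R (cl_one :: 'n clifford))"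
    by simp
  then show ?thesis by (metis real_vector.scale_cancel_left zero_neq_numeral)
qed

text \<open>A type \<open>'w\<close> of class \<open>euclidean_space\<close> is used as a nonzero finite-dimensional real vector
  space; its inner product plays no role here.\<close>

definition clifford_representation ::
  "('n::{finite, linorder} clifford \<Rightarrow> 'w::euclidean_space \<Rightarrow> 'w) \<Rightarrow> bool" where
  "clifford_representation \<rho> \<longleftrightarrow>
     (\<forall>a. linear (\<rho> a)) \<and> (\<forall>w. linear (\<lambda>a. \<rho> a w)) \<and>
     \<rho> cl_one = id \<and> (\<forall>a b. \<rho> (cl_mult a b) = \<rho> a \<circ> \<rho> b)"

definition irreducible_clifford_representation ::
  "('n::{finite, linorder} clifford \<Rightarrow> 'w::euclidean_space \<Rightarrow> 'w) \<Rightarrow> bool" where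
  "irreducible_clifford_representation \<rho> \<longleftrightarrow>
     clifford_representation \<rho> \<and>
     (\<forall>V. subspace V \<and> (\<forall>a. \<rho> a ` V \<subseteq> V) \<longrightarrow> V = {0} \<or> V = UNIV)"


section \<open>Spinors and the Dirac operator\<close>

definition spinor_on_quotient ::
  "'g monoid \<Rightarrow> ('g::topological_space, 'e::real_normed_vector) atlas \<Rightarrow> 'g set \<Rightarrow>
   ('g \<Rightarrow> 'w::real_normed_vector) \<Rightarrow> bool" where
  "spinor_on_quotient G A \<Gamma> \<phi> \<longleftrightarrow>
     smooth_fun A \<phi> \<and> (\<forall>y\<in>\<Gamma>. \<forall>x. \<phi> (y \<otimes>\<^bsub>G\<^esub> x) = \<phi> x)"

definition left_invariant_spinor :: "('g \<Rightarrow> 'w) \<Rightarrow> bool" where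
  "left_invariant_spinor \<phi> \<longleftrightarrow> (\<exists>w. \<forall>x. \<phi> x = w)"

definition spin_connection ::
  "('g \<Rightarrow> 'g tangent \<Rightarrow> 'g tangent \<Rightarrow> real) \<Rightarrow> ('g vfield \<Rightarrow> 'g vfield \<Rightarrow> 'g vfield) \<Rightarrow>
   ('n::{finite, linorder} \<Rightarrow> 'g vfield) \<Rightarrow> ('n clifford \<Rightarrow> 'w::euclidean_space \<Rightarrow> 'w) \<Rightarrow>
   'g vfield \<Rightarrow> ('g \<Rightarrow> 'w) \<Rightarrow> 'g \<Rightarrow> 'w" where
  "spin_connection g nabla e \<rho> X \<phi> p =
     dir_deriv (X p) \<phi> +
     (1 / 2) *\<^sub>R (\<Sum>(j, k)\<in>{(j, k). j < k}.
        g p (nabla X (e j) p) (e k p) *\<^sub>R \<rho> (cl_mult (cl_gen j) (cl_gen k)) (\<phi> p))"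

definition dirac_operator ::
  "('g \<Rightarrow> 'g tangent \<Rightarrow> 'g tangent \<Rightarrow> real) \<Rightarrow> ('g vfield \<Rightarrow> 'g vfield \<Rightarrow> 'g vfield) \<Rightarrow>
   ('n::{finite, linorder} \<Rightarrow> 'g vfield) \<Rightarrow> ('n clifford \<Rightarrow> 'w::euclidean_space \<Rightarrow> 'w) \<Rightarrow>
   ('g \<Rightarrow> 'w) \<Rightarrow> 'g \<Rightarrow> 'w" where
  "dirac_operator g nabla e \<rho> \<phi> p =
     (\<Sum>i\<in>UNIV. \<rho> (cl_gen i) (spin_connection g nabla e \<rho> (e i) \<phi> p))"

definition harmonic_spinor ::
  "('g \<Rightarrow> 'g tangent \<Rightarrow> 'g tangent \<Rightarrow> real) \<Rightarrow> ('g vfield \<Rightarrow> 'g vfield \<Rightarrow> 'g vfield) \<Rightarrow>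
   ('n::{finite, linorder} \<Rightarrow> 'g vfield) \<Rightarrow> ('n clifford \<Rightarrow> 'w::euclidean_space \<Rightarrow> 'w) \<Rightarrow>
   ('g \<Rightarrow> 'w) \<Rightarrow> bool" where
  "harmonic_spinor g nabla e \<rho> \<phi> \<longleftrightarrow> (\<forall>p. dirac_operator g nabla e \<rho> \<phi> p = 0)"

end

theory Submission
  imports Defs
begin

text \<open>For a constant spinor \<open>w\<close>, \<open>4 D w = \<Sum> \<omega>\<^sub>i\<^sub>j\<^sub>k e\<^sub>i e\<^sub>j e\<^sub>k w\<close> with \<open>\<omega>\<^sub>i\<^sub>j\<^sub>k\<close> the connection
  coefficients of the frame. The terms with a repeated index add up to the traces of the operators
  \<open>ad\<close>, which vanish because these are nilpotent. What remains is Clifford multiplication by the 3-form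
  \<open>T\<^sub>i\<^sub>j\<^sub>k = c\<^sub>i\<^sub>j\<^sub>k + c\<^sub>j\<^sub>k\<^sub>i + c\<^sub>k\<^sub>i\<^sub>j\<close>; in dimension 4 this is the volume element times a vector, hence
  injective unless \<open>T = 0\<close>. A nonabelian nilpotent Lie algebra has a nonzero central element
  \<open>z = [x, y]\<close>, and then \<open>T(x, y, z) = |z|\<^sup>2 \<noteq> 0\<close>.

  The passage from the group to the Lie algebra avoids the exponential map. The right-invariant fields
  are \<open>r\<^sub>l = \<Sum> a\<^sub>j\<^sub>l e\<^sub>j\<close> with \<open>a(x) = Ad(x\<^sup>-\<^sup>1)\<close>, and they commute with the \<open>e\<^sub>i\<close>, which
  expresses the derivatives of \<open>a\<close> by the structure constants. The differential at 1 of
  \<open>y \<mapsto> x\<^sup>-\<^sup>1 y x y\<^sup>-\<^sup>1\<close> is \<open>a(x) - 1\<close>, so if \<open>k\<close>-fold group commutators are trivial, then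
  \<open>(a(x\<^sub>1) - 1) \<cdots> (a(x\<^sub>k) - 1) = 0\<close>; differentiating in every \<open>x\<^sub>i\<close> at 1 gives the nilpotency of \<open>ad\<close>.
  If all structure constants vanish, then \<open>a = 1\<close> by connectedness, commutator maps are locally
  constant, and the group is abelian.\<close>

section \<open>Smooth maps between vector spaces\<close>

lemma Ck_on_cong:
  assumes "open S" "\<And>x. x \<in> S \<Longrightarrow> f x = g x" "Ck_on k S f"
  shows "Ck_on k S g"
  using assms(2,3)
proof (induction k arbitrary: f g)
  case 0
  then show ?case using continuous_on_cong[of S S f g] by simp
next
  case (Suc k)
  have d: "(g has_derivative frechet_derivative f (at x)) (at x)" if "x \<in> S" for x
  proof (rule has_derivative_transform_within_open[OF _ assms(1) that])
    show "(f has_derivative frechet_derivative f (at x)) (at x)"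
      using Suc.prems(2) that frechet_derivative_works by auto
  qed (rule Suc.prems)
  have "Ck_on k S (\<lambda>x. frechet_derivative g (at x) v)" for v
  proof (rule Suc.IH)
    show "Ck_on k S (\<lambda>x. frechet_derivative f (at x) v)" using Suc.prems(2) by simp
    show "frechet_derivative f (at x) v = frechet_derivative g (at x) v" if "x \<in> S" for x
      using frechet_derivative_at[OF d[OF that]] by simp
  qed
  then show ?case using d by (auto simp: differentiable_def)
qed

text \<open>Any explicit derivative may stand in for \<open>frechet_derivative\<close>, by
  uniqueness of derivatives. The closure properties below thus become inductions on the order that
  use the differentiation rules directly.\<close>

lemma Ck_on_SucI:
  assumes "open S" "\<And>x. x \<in> S \<Longrightarrow> (f has_derivative f' x) (at x)"
    "\<And>v. Ck_on k S (\<lambda>x. f' x v)"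
  shows "Ck_on (Suc k) S f"
proof -
  have "Ck_on k S (\<lambda>x. frechet_derivative f (at x) v)" for v
  proof (rule Ck_on_cong[OF assms(1)])
    show "Ck_on k S (\<lambda>x. f' x v)" by (rule assms(3))
    show "f' x v = frechet_derivative f (at x) v" if "x \<in> S" for x
      using frechet_derivative_at[OF assms(2)[OF that]] by simp
  qed
  then show ?thesis using assms(2) by (auto simp: differentiable_def)
qed

lemma Ck_on_has_derivative:
  assumes "Ck_on (Suc k) S f" "x \<in> S"
  shows "(f has_derivative frechet_derivative f (at x)) (at x)"
  using assms frechet_derivative_works by auto

lemma Ck_on_subset: "Ck_on k S f \<Longrightarrow> T \<subseteq> S \<Longrightarrow> Ck_on k T f"
  by (induction k arbitrary: f) (auto intro: continuous_on_subset)

lemma Ck_on_pred: "Ck_on (Suc k) S f \<Longrightarrow> Ck_on k S f"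
proof (induction k arbitrary: f)
  case 0
  then show ?case
    by (auto intro!: continuous_at_imp_continuous_on differentiable_imp_continuous_within)
qed auto

lemma Ck_on_const: "open S \<Longrightarrow> Ck_on k S (\<lambda>x. c)"
proof (induction k arbitrary: c)
  case (Suc k)
  then show ?case by (intro Ck_on_SucI[where f'="\<lambda>x v. 0"]) auto
qed auto

lemma Ck_on_bounded_linear_compose:
  assumes "bounded_linear L" "open S" "Ck_on k S f"
  shows "Ck_on k S (\<lambda>x. L (f x))"
  using assms(3)
proof (induction k arbitrary: f)
  case 0
  then show ?case using bounded_linear.continuous_on[OF assms(1)] by auto
next
  case (Suc k)
  show ?case
    by (intro Ck_on_SucI[where f'="\<lambda>x v. L (frechet_derivative f (at x) v)"] assms(2)
        bounded_linear.has_derivative[OF assms(1)] Ck_on_has_derivative[OF Suc.prems] Suc.IH)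
      (use Suc.prems in auto)
qed

lemma Ck_on_add:
  assumes "open S" "Ck_on k S f" "Ck_on k S g"
  shows "Ck_on k S (\<lambda>x. f x + g x)"
  using assms(2,3)
proof (induction k arbitrary: f g)
  case 0
  then show ?case by (simp add: continuous_on_add)
next
  case (Suc k)
  show ?case
    by (intro Ck_on_SucI[where f'="\<lambda>x v. frechet_derivative f (at x) v + frechet_derivative g (at x) v"]
        assms(1) has_derivative_add Ck_on_has_derivative[OF Suc.prems(1)]
        Ck_on_has_derivative[OF Suc.prems(2)] Suc.IH)
      (use Suc.prems in auto)
qed

lemma Ck_on_sum:
  assumes "open S" "\<And>i. i \<in> I \<Longrightarrow> Ck_on k S (f i)"
  shows "Ck_on k S (\<lambda>x. \<Sum>i\<in>I. f i x)"
  using assms(2)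
  by (induction I rule: infinite_finite_induct) (auto intro: Ck_on_const Ck_on_add assms(1))

text \<open>Leibniz rule and induction. The undifferentiated factors are known at order
  \<open>Suc k\<close> but are needed at order \<open>k\<close>, which is what
  \<open>Ck_on_pred\<close> is for.\<close>

lemma Ck_on_bilinear:
  assumes "bounded_bilinear B" "open S" "Ck_on k S f" "Ck_on k S g"
  shows "Ck_on k S (\<lambda>x. B (f x) (g x))"
  using assms(3,4)
proof (induction k arbitrary: f g)
  case 0
  then show ?case using bounded_bilinear.continuous_on[OF assms(1)] by auto
next
  case (Suc k)
  show ?case
    by (intro Ck_on_SucI[where f'="\<lambda>x v. B (f x) (frechet_derivative g (at x) v)
          + B (frechet_derivative f (at x) v) (g x)"]
        assms(2) bounded_bilinear.FDERIV[OF assms(1)] Ck_on_has_derivative[OF Suc.prems(1)]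
        Ck_on_has_derivative[OF Suc.prems(2)] Ck_on_add Suc.IH Ck_on_pred[OF Suc.prems(1)]
        Ck_on_pred[OF Suc.prems(2)])
      (use Suc.prems in auto)
qed

lemma Ck_on_Pair:
  assumes "open S" "Ck_on k S f" "Ck_on k S g"
  shows "Ck_on k S (\<lambda>x. (f x, g x))"
proof -
  have "Ck_on k S (\<lambda>x. (f x, 0) + (0, g x))"
    by (intro Ck_on_add Ck_on_bounded_linear_compose[of "\<lambda>y. (y, 0)"]
        Ck_on_bounded_linear_compose[of "\<lambda>y. (0, y)"] assms)
      (auto intro: bounded_linear_Pair bounded_linear_ident bounded_linear_zero)
  then show ?thesis by simp
qed

text \<open>The inductive definition differentiates in a fixed direction, whereas the chain rule
  evaluates the outer derivative in the moving direction \<open>?g' x v\<close>. Expanding that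
  direction over the finite basis of the middle space leaves fixed directions \<open>b\<close> with
  scalar coefficients, to which the induction applies.\<close>

lemma Ck_on_compose:
  fixes g :: "'a::real_normed_vector \<Rightarrow> 'b::euclidean_space" and f :: "'b \<Rightarrow> 'c::real_normed_vector"
  assumes "open S" "open T" "g ` S \<subseteq> T" "Ck_on k T f" "Ck_on k S g"
  shows "Ck_on k S (f \<circ> g)"
  using assms(4,5)
proof (induction k arbitrary: f)
  case 0
  then show ?case using assms(3) continuous_on_compose continuous_on_subset by (metis Ck_on.simps(1))
next
  case (Suc k)
  let ?f' = "\<lambda>y. frechet_derivative f (at y)" and ?g' = "\<lambda>x. frechet_derivative g (at x)"
  show ?case
  proof (rule Ck_on_SucI[OF assms(1)])
    fix x assume x: "x \<in> S"
    then have gx: "g x \<in> T" using assms(3) by auto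
    have "(f \<circ> g has_derivative ?f' (g x) \<circ> ?g' x) (at x)"
      by (rule diff_chain_at[OF Ck_on_has_derivative[OF Suc.prems(2) x] Ck_on_has_derivative[OF Suc.prems(1) gx]])
    moreover have "?f' (g x) \<circ> ?g' x = (\<lambda>v. \<Sum>b\<in>Basis. (?g' x v \<bullet> b) *\<^sub>R ?f' (g x) b)"
    proof
      fix v
      have l: "linear (?f' (g x))"
        using Ck_on_has_derivative[OF Suc.prems(1) gx] has_derivative_linear by blast
      show "(?f' (g x) \<circ> ?g' x) v = (\<Sum>b\<in>Basis. (?g' x v \<bullet> b) *\<^sub>R ?f' (g x) b)"
        using linear_sum[OF l, of "\<lambda>b. (?g' x v \<bullet> b) *\<^sub>R b" Basis]
        by (simp add: euclidean_representation linear_scale[OF l])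
    qed
    ultimately show "(f \<circ> g has_derivative (\<lambda>v. \<Sum>b\<in>Basis. (?g' x v \<bullet> b) *\<^sub>R ?f' (g x) b)) (at x)"
      by simp
  next
    fix v
    have "Ck_on k S ((\<lambda>y. ?f' y b) \<circ> g)" for b
      by (rule Suc.IH) (use Suc.prems Ck_on_pred in auto)
    moreover have "Ck_on k S (\<lambda>x. ?g' x v)" using Suc.prems by auto
    ultimately show "Ck_on k S (\<lambda>x. \<Sum>b\<in>Basis. (?g' x v \<bullet> b) *\<^sub>R ?f' (g x) b)"
      by (intro Ck_on_sum assms(1) Ck_on_bilinear[OF bounded_bilinear_scaleR]
          Ck_on_bounded_linear_compose[OF bounded_linear_inner_left]) (auto simp: o_def)
  qed
qed

section \<open>Smooth functions on open sets\<close>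

lemma smooth_on_open: "smooth_on S f \<Longrightarrow> open S"
  by (simp add: smooth_on_def)

lemma smooth_on_subset: "smooth_on S f \<Longrightarrow> T \<subseteq> S \<Longrightarrow> open T \<Longrightarrow> smooth_on T f"
  by (auto simp: smooth_on_def intro: Ck_on_subset)

lemma smooth_on_cong: "smooth_on S f \<Longrightarrow> (\<And>x. x \<in> S \<Longrightarrow> f x = g x) \<Longrightarrow> smooth_on S g"
  unfolding smooth_on_def using Ck_on_cong by blast

lemma smooth_on_compose:
  fixes g :: "'a::real_normed_vector \<Rightarrow> 'b::euclidean_space" and f :: "'b \<Rightarrow> 'c::real_normed_vector"
  assumes "smooth_on T f" "smooth_on S g" "g ` S \<subseteq> T"
  shows "smooth_on S (f \<circ> g)"
  using assms Ck_on_compose unfolding smooth_on_def by blast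

lemma smooth_on_continuous: "smooth_on S f \<Longrightarrow> continuous_on S f"
  unfolding smooth_on_def using Ck_on.simps(1) by blast

lemma smooth_on_has_derivative:
  "smooth_on S f \<Longrightarrow> x \<in> S \<Longrightarrow> (f has_derivative frechet_derivative f (at x)) (at x)"
  using Ck_on_has_derivative smooth_on_def by blast

lemma smooth_on_linear_frechet_derivative:
  "smooth_on S f \<Longrightarrow> x \<in> S \<Longrightarrow> linear (frechet_derivative f (at x))"
  using smooth_on_has_derivative has_derivative_linear by blast

lemma smooth_on_frechet_derivative:
  "smooth_on S f \<Longrightarrow> smooth_on S (\<lambda>x. frechet_derivative f (at x) v)"
  unfolding smooth_on_def by (metis Ck_on.simps(2))

lemma smooth_on_Pair:
  "smooth_on S f \<Longrightarrow> smooth_on S g \<Longrightarrow> smooth_on S (\<lambda>x. (f x, g x))"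
  by (auto simp: smooth_on_def intro: Ck_on_Pair)

lemma smooth_on_bounded_linear_compose:
  "bounded_linear L \<Longrightarrow> smooth_on S f \<Longrightarrow> smooth_on S (\<lambda>x. L (f x))"
  by (auto simp: smooth_on_def intro: Ck_on_bounded_linear_compose)

lemma smooth_on_id: "open S \<Longrightarrow> smooth_on S (\<lambda>x. x)"
proof -
  assume o: "open S"
  have "Ck_on k S (\<lambda>x. x)" for k
  proof (cases k)
    case (Suc j)
    then show ?thesis using o
      by (auto intro!: Ck_on_SucI[where f'="\<lambda>x v. v"] Ck_on_const)
  qed auto
  then show ?thesis using o by (simp add: smooth_on_def)
qed

lemma smooth_on_const: "open S \<Longrightarrow> smooth_on S (\<lambda>x. c)"
  by (auto simp: smooth_on_def intro: Ck_on_const)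

lemma smooth_on_add: "smooth_on S f \<Longrightarrow> smooth_on S g \<Longrightarrow> smooth_on S (\<lambda>x. f x + g x)"
  by (auto simp: smooth_on_def intro: Ck_on_add)

lemma smooth_on_mult:
  fixes f g :: "'a::real_normed_vector \<Rightarrow> real"
  shows "smooth_on S f \<Longrightarrow> smooth_on S g \<Longrightarrow> smooth_on S (\<lambda>x. f x * g x)"
  by (auto simp: smooth_on_def intro: Ck_on_bilinear[OF bounded_bilinear_mult])

section \<open>Symmetry of second derivatives\<close>

lemma second_difference_limit:
  fixes f :: "'a::real_normed_vector \<Rightarrow> real"
  assumes f: "smooth_on S f" and x: "x \<in> S"
  shows "((\<lambda>h. (f (x + h *\<^sub>R u + h *\<^sub>R v) - f (x + h *\<^sub>R u) - f (x + h *\<^sub>R v) + f x) / h^2) \<longlongrightarrow>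
     frechet_derivative (\<lambda>y. frechet_derivative f (at y) u) (at x) v) (at_right 0)"
proof -
  let ?Du = "\<lambda>y. frechet_derivative f (at y) u"
  let ?Dvu = "\<lambda>y. frechet_derivative ?Du (at y) v"
  have Du: "smooth_on S ?Du" by (rule smooth_on_frechet_derivative[OF f])
  have Dvu: "smooth_on S ?Dvu" by (rule smooth_on_frechet_derivative[OF Du])
  have c: "isCont ?Dvu x"
    using smooth_on_continuous[OF Dvu] smooth_on_open[OF f] x continuous_on_eq_continuous_at by blast
  show ?thesis
  proof (rule tendstoI)
    fix \<epsilon> :: real assume "\<epsilon> > 0"
    from c this obtain d1 where d1: "d1 > 0" "\<And>y. dist y x < d1 \<Longrightarrow> dist (?Dvu y) (?Dvu x) < \<epsilon>"
      unfolding continuous_at_eps_delta by metis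
    obtain d2 where d2: "d2 > 0" "ball x d2 \<subseteq> S"
      using smooth_on_open[OF f] x open_contains_ball by blast
    \<comment> \<open>For \<open>h < d\<close> the whole parallelogram spanned by
      \<open>h *\<^sub>R u\<close> and \<open>h *\<^sub>R v\<close> at \<open>x\<close> lies in
      \<open>S\<close> and within \<open>d1\<close> of \<open>x\<close>. The summand 1 keeps the
      denominator positive when both directions vanish.\<close>
    define d where "d = min d1 d2 / (norm u + norm v + 1)"
    have n: "norm u + norm v + 1 > 0" by (smt (verit) norm_ge_zero)
    have d: "d > 0" unfolding d_def using d1 d2 n by auto
    have near: "dist (x + s *\<^sub>R u + t *\<^sub>R v) x < min d1 d2" if "0 \<le> s" "s \<le> h" "0 \<le> t" "t \<le> h" "0 < h" "h < d" for s t h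
    proof -
      have "dist (x + s *\<^sub>R u + t *\<^sub>R v) x = norm (s *\<^sub>R u + t *\<^sub>R v)" by (simp add: dist_norm)
      also have "\<dots> \<le> s * norm u + t * norm v" using that norm_triangle_ineq[of "s *\<^sub>R u" "t *\<^sub>R v"] by simp
      also have "\<dots> \<le> h * norm u + h * norm v" using that by (intro add_mono mult_right_mono) auto
      also have "\<dots> < h * (norm u + norm v + 1)" using that by (simp add: algebra_simps)
      also have "\<dots> < min d1 d2" using that(6) n unfolding d_def by (simp add: pos_less_divide_eq)
      finally show ?thesis .
    qed
    have inS: "x + s *\<^sub>R u + t *\<^sub>R v \<in> S" if "0 \<le> s" "s \<le> h" "0 \<le> t" "t \<le> h" "0 < h" "h < d" for s t h
      using near[OF that] d2(2) by (auto simp: dist_commute subset_iff)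
    have "dist ((f (x + h *\<^sub>R u + h *\<^sub>R v) - f (x + h *\<^sub>R u) - f (x + h *\<^sub>R v) + f x) / h^2) (?Dvu x) < \<epsilon>"
      if h: "0 < h" "h < d" for h
    proof -
      \<comment> \<open>The second difference is \<open>\<phi> h - \<phi> 0\<close>. The mean value
        theorem along \<open>u\<close> and then along \<open>v\<close> turns it into
        \<open>h^2\<close> times the iterated derivative at a point of the parallelogram, and
        continuity of that derivative finishes the estimate.\<close>
      define \<phi> where "\<phi> = (\<lambda>s. f (x + s *\<^sub>R u + h *\<^sub>R v) - f (x + s *\<^sub>R u))"
      have \<phi>': "(\<phi> has_real_derivative (?Du (x + s *\<^sub>R u + h *\<^sub>R v) - ?Du (x + s *\<^sub>R u))) (at s)"
        if s: "0 \<le> s" "s \<le> h" for s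
      proof -
        have a: "((\<lambda>s. f (x + s *\<^sub>R u + t *\<^sub>R v)) has_derivative
           (\<lambda>r. frechet_derivative f (at (x + s *\<^sub>R u + t *\<^sub>R v)) (r *\<^sub>R u))) (at s)" if "0 \<le> t" "t \<le> h" for t
          by (rule has_derivative_compose[of "\<lambda>s. x + s *\<^sub>R u + t *\<^sub>R v" "\<lambda>r. r *\<^sub>R u" s UNIV f,
              OF _ smooth_on_has_derivative[OF f]])
            (use inS s h that in \<open>auto intro!: derivative_eq_intros\<close>)
        have lin: "linear (frechet_derivative f (at (x + s *\<^sub>R u + t *\<^sub>R v)))" if "0 \<le> t" "t \<le> h" for t
          by (rule smooth_on_linear_frechet_derivative[OF f]) (use inS s h that in auto)
        have "(\<phi> has_derivative (\<lambda>r. frechet_derivative f (at (x + s *\<^sub>R u + h *\<^sub>R v)) (r *\<^sub>R u)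
            - frechet_derivative f (at (x + s *\<^sub>R u)) (r *\<^sub>R u))) (at s)"
          unfolding \<phi>_def using has_derivative_diff[OF a[of h] a[of 0]] h by simp
        moreover have "(\<lambda>r. frechet_derivative f (at (x + s *\<^sub>R u + h *\<^sub>R v)) (r *\<^sub>R u)
            - frechet_derivative f (at (x + s *\<^sub>R u)) (r *\<^sub>R u))
            = (*) (?Du (x + s *\<^sub>R u + h *\<^sub>R v) - ?Du (x + s *\<^sub>R u))"
          using linear_scale[OF lin[of h]] linear_scale[OF lin[of 0]] h by (auto simp: algebra_simps)
        ultimately show ?thesis unfolding has_field_derivative_def by simp
      qed
      obtain s where s: "0 < s" "s < h" "\<phi> h - \<phi> 0 = (h - 0) * (?Du (x + s *\<^sub>R u + h *\<^sub>R v) - ?Du (x + s *\<^sub>R u))"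
        using MVT2[OF h(1), of \<phi> "\<lambda>s. ?Du (x + s *\<^sub>R u + h *\<^sub>R v) - ?Du (x + s *\<^sub>R u)"] \<phi>' by blast
      have "((\<lambda>t. ?Du (x + s *\<^sub>R u + t *\<^sub>R v)) has_real_derivative ?Dvu (x + s *\<^sub>R u + t *\<^sub>R v)) (at t)"
        if t: "0 \<le> t" "t \<le> h" for t
      proof -
        have "((\<lambda>t. ?Du (x + s *\<^sub>R u + t *\<^sub>R v)) has_derivative
           (\<lambda>r. frechet_derivative ?Du (at (x + s *\<^sub>R u + t *\<^sub>R v)) (r *\<^sub>R v))) (at t)"
          by (rule has_derivative_compose[of "\<lambda>t. x + s *\<^sub>R u + t *\<^sub>R v" "\<lambda>r. r *\<^sub>R v" t UNIV ?Du,
              OF _ smooth_on_has_derivative[OF Du]])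
            (use inS[of s h t] s h t in \<open>auto intro!: derivative_eq_intros\<close>)
        moreover have "linear (frechet_derivative ?Du (at (x + s *\<^sub>R u + t *\<^sub>R v)))"
          by (rule smooth_on_linear_frechet_derivative[OF Du]) (use inS[of s h t] s h t in auto)
        ultimately show ?thesis unfolding has_field_derivative_def by (simp add: linear_scale mult_commute_abs)
      qed
      then obtain t where t: "0 < t" "t < h"
        "?Du (x + s *\<^sub>R u + h *\<^sub>R v) - ?Du (x + s *\<^sub>R u + 0 *\<^sub>R v) = (h - 0) * ?Dvu (x + s *\<^sub>R u + t *\<^sub>R v)"
        using MVT2[OF h(1), of "\<lambda>t. ?Du (x + s *\<^sub>R u + t *\<^sub>R v)" "\<lambda>t. ?Dvu (x + s *\<^sub>R u + t *\<^sub>R v)"] by blast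
      have "f (x + h *\<^sub>R u + h *\<^sub>R v) - f (x + h *\<^sub>R u) - f (x + h *\<^sub>R v) + f x = \<phi> h - \<phi> 0"
        by (simp add: \<phi>_def)
      also have "\<dots> = h^2 * ?Dvu (x + s *\<^sub>R u + t *\<^sub>R v)"
        using s(3) t(3) by (simp add: power2_eq_square)
      finally have "(f (x + h *\<^sub>R u + h *\<^sub>R v) - f (x + h *\<^sub>R u) - f (x + h *\<^sub>R v) + f x) / h^2 = ?Dvu (x + s *\<^sub>R u + t *\<^sub>R v)"
        using h by simp
      then show ?thesis using d1(2) near[of s h t] s t h by simp
    qed
    then show "\<forall>\<^sub>F h in at_right 0. dist ((f (x + h *\<^sub>R u + h *\<^sub>R v) - f (x + h *\<^sub>R u) - f (x + h *\<^sub>R v) + f x) / h^2) (?Dvu x) < \<epsilon>"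
      using d eventually_at_right_field by blast
  qed
qed

text \<open>The second difference does not change when \<open>u\<close> and \<open>v\<close> are
  swapped, so both iterated derivatives are limits of the same quotient.\<close>

lemma symmetric_second_derivative:
  fixes f :: "'a::real_normed_vector \<Rightarrow> real"
  assumes "smooth_on S f" "x \<in> S"
  shows "frechet_derivative (\<lambda>y. frechet_derivative f (at y) u) (at x) v =
         frechet_derivative (\<lambda>y. frechet_derivative f (at y) v) (at x) u"
proof (rule tendsto_unique[OF _ second_difference_limit[OF assms]])
  have "(f (x + h *\<^sub>R v + h *\<^sub>R u) - f (x + h *\<^sub>R v) - f (x + h *\<^sub>R u) + f x) / h^2 =
      (f (x + h *\<^sub>R u + h *\<^sub>R v) - f (x + h *\<^sub>R u) - f (x + h *\<^sub>R v) + f x) / h^2" for h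
    by (simp add: add_ac)
  then show "((\<lambda>h. (f (x + h *\<^sub>R u + h *\<^sub>R v) - f (x + h *\<^sub>R u) - f (x + h *\<^sub>R v) + f x) / h^2) \<longlongrightarrow>
     frechet_derivative (\<lambda>y. frechet_derivative f (at y) v) (at x) u) (at_right 0)"
    using second_difference_limit[OF assms, of v u] by presburger
qed simp

section \<open>Smooth functions and tangent vectors\<close>

locale manifold =
  fixes A :: "('g::topological_space, 'e::euclidean_space) atlas"
  assumes smooth_atlas: "smooth_atlas A"
begin

section \<open>Charts and smoothness near a point\<close>

lemma chart:
  assumes "(U, c) \<in> A"
  shows chart_open: "open U" "open (c ` U)"
    and chart_continuous: "continuous_on U c" "continuous_on (c ` U) (inv_into U c)"
    and chart_inverse: "x \<in> U \<Longrightarrow> inv_into U c (c x) = x"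
proof -
  have h: "open U \<and> open (c ` U) \<and> homeomorphism U (c ` U) c (inv_into U c)"
    using smooth_atlas assms unfolding smooth_atlas_def by fast
  then show "open U" "open (c ` U)" "continuous_on U c" "continuous_on (c ` U) (inv_into U c)"
    "x \<in> U \<Longrightarrow> inv_into U c (c x) = x"
    unfolding homeomorphism_def by auto
qed

lemma chart_at: obtains U c where "(U, c) \<in> A" "p \<in> U"
proof -
  have "p \<in> \<Union> (fst ` A)" using smooth_atlas unfolding smooth_atlas_def by simp
  then show thesis using that by auto
qed

lemma chart_transition:
  "(U, c) \<in> A \<Longrightarrow> (V, d) \<in> A \<Longrightarrow> smooth_on (c ` (U \<inter> V)) (d \<circ> inv_into U c)"
  using smooth_atlas unfolding smooth_atlas_def by fast

lemma open_chart_image: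
  assumes "(U, c) \<in> A" "open N" "N \<subseteq> U"
  shows "open (c ` N)"
proof -
  have "c ` N = c ` U \<inter> inv_into U c -` N"
    using assms chart_inverse[OF assms(1)] by (auto simp: image_iff)
  then show ?thesis
    using continuous_open_preimage[OF chart_continuous(2)[OF assms(1)] chart_open(2)[OF assms(1)] assms(2)] by simp
qed

lemma open_chart_preimage: "(U, c) \<in> A \<Longrightarrow> open S \<Longrightarrow> open (U \<inter> c -` S)"
  by (intro continuous_open_preimage chart_continuous chart_open)

lemma smooth_nearI:
  "(U, c) \<in> A \<Longrightarrow> open N \<Longrightarrow> p \<in> N \<Longrightarrow> N \<subseteq> U \<Longrightarrow> smooth_on (c ` N) (f \<circ> inv_into U c) \<Longrightarrow>
     smooth_near A p f"
  unfolding smooth_near_def by blast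

text \<open>\<open>smooth_near\<close> only provides some chart; the smooth transition maps carry
  the property over to any chart around the point.\<close>

lemma smooth_nearE:
  assumes "smooth_near A p f" "(V, d) \<in> A" "p \<in> V"
  obtains N where "open N" "p \<in> N" "N \<subseteq> V" "smooth_on (d ` N) (f \<circ> inv_into V d)"
proof -
  obtain U c N0 where U: "(U, c) \<in> A" "open N0" "p \<in> N0" "N0 \<subseteq> U"
    and f: "smooth_on (c ` N0) (f \<circ> inv_into U c)"
    using assms(1) unfolding smooth_near_def by blast
  let ?N = "N0 \<inter> V"
  have oN: "open ?N" using U chart_open[OF assms(2)] by auto
  have o: "open (d ` ?N)" by (rule open_chart_image[OF assms(2) oN]) auto
  have "smooth_on (d ` ?N) ((f \<circ> inv_into U c) \<circ> (c \<circ> inv_into V d))"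
  proof (rule smooth_on_compose[OF f])
    show "smooth_on (d ` ?N) (c \<circ> inv_into V d)"
      by (rule smooth_on_subset[OF chart_transition[OF assms(2) U(1)] _ o]) (use U in auto)
  qed (use chart_inverse[OF assms(2)] in auto)
  then have "smooth_on (d ` ?N) (f \<circ> inv_into V d)"
    by (rule smooth_on_cong)
      (use chart_inverse[OF assms(2)] chart_inverse[OF U(1)] U(4) in auto)
  then show thesis using that oN U assms by blast
qed

lemma smooth_near_cong:
  assumes "smooth_near A p f" "open N" "p \<in> N" "\<And>x. x \<in> N \<Longrightarrow> f x = g x"
  shows "smooth_near A p g"
proof -
  obtain U c M where U: "(U, c) \<in> A" "open M" "p \<in> M" "M \<subseteq> U"
    and f: "smooth_on (c ` M) (f \<circ> inv_into U c)"
    using assms(1) unfolding smooth_near_def by blast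
  have "open (c ` (M \<inter> N))" by (rule open_chart_image[OF U(1)]) (use U assms in auto)
  then have "smooth_on (c ` (M \<inter> N)) (f \<circ> inv_into U c)"
    by (rule smooth_on_subset[OF f, rotated]) auto
  then have "smooth_on (c ` (M \<inter> N)) (g \<circ> inv_into U c)"
    by (rule smooth_on_cong) (use chart_inverse[OF U(1)] U(4) assms(4) in auto)
  then show ?thesis by (intro smooth_nearI[OF U(1), of "M \<inter> N"]) (use U assms in auto)
qed

lemma smooth_near_nbhd:
  assumes "smooth_near A p f"
  obtains N where "open N" "p \<in> N" "\<And>q. q \<in> N \<Longrightarrow> smooth_near A q f" "continuous_on N f"
proof -
  obtain U c M where U: "(U, c) \<in> A" "open M" "p \<in> M" "M \<subseteq> U"
    and f: "smooth_on (c ` M) (f \<circ> inv_into U c)"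
    using assms(1) unfolding smooth_near_def by blast
  have "continuous_on M ((f \<circ> inv_into U c) \<circ> c)"
    by (rule continuous_on_compose)
      (use chart_continuous[OF U(1)] U(4) smooth_on_continuous[OF f] continuous_on_subset in blast)+
  then have "continuous_on M f"
    by (rule continuous_on_cong[THEN iffD1, rotated 2])
      (use chart_inverse[OF U(1)] U(4) in auto)
  then show thesis using that[of M] smooth_nearI[OF U(1) U(2) _ U(4) f] U by blast
qed

lemma smooth_near_compose:
  fixes \<phi> :: "'g \<Rightarrow> 'b::euclidean_space"
  assumes "smooth_near A p \<phi>" "smooth_on S H" "\<phi> p \<in> S"
  shows "smooth_near A p (\<lambda>x. H (\<phi> x))"
proof -
  obtain U c where U: "(U, c) \<in> A" "p \<in> U" by (rule chart_at)
  obtain N where N: "open N" "p \<in> N" "N \<subseteq> U" "smooth_on (c ` N) (\<phi> \<circ> inv_into U c)"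
    using smooth_nearE[OF assms(1) U] .
  obtain M where M: "open M" "p \<in> M" "continuous_on M \<phi>"
    using smooth_near_nbhd[OF assms(1)] by metis
  let ?K = "N \<inter> (M \<inter> \<phi> -` S)"
  have K: "open ?K" using continuous_open_preimage[OF M(3,1)] smooth_on_open[OF assms(2)] N by auto
  have o: "open (c ` ?K)" by (rule open_chart_image[OF U(1) K]) (use N in auto)
  have "smooth_on (c ` ?K) (H \<circ> (\<phi> \<circ> inv_into U c))"
    by (rule smooth_on_compose[OF assms(2) smooth_on_subset[OF N(4) _ o]])
      (use chart_inverse[OF U(1)] N(3) in auto)
  then show ?thesis
    by (intro smooth_nearI[OF U(1) K]) (use N M assms in \<open>auto simp: o_def\<close>)
qed

lemma smooth_near_Pair:
  assumes "smooth_near A p f" "smooth_near A p g"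
  shows "smooth_near A p (\<lambda>x. (f x, g x))"
proof -
  obtain U c where U: "(U, c) \<in> A" "p \<in> U" by (rule chart_at)
  obtain N where N: "open N" "p \<in> N" "N \<subseteq> U" "smooth_on (c ` N) (f \<circ> inv_into U c)"
    using smooth_nearE[OF assms(1) U] .
  obtain M where M: "open M" "p \<in> M" "M \<subseteq> U" "smooth_on (c ` M) (g \<circ> inv_into U c)"
    using smooth_nearE[OF assms(2) U] .
  have o: "open (c ` (M \<inter> N))" by (rule open_chart_image[OF U(1)]) (use N M in auto)
  have "smooth_on (c ` (M \<inter> N)) (\<lambda>y. ((f \<circ> inv_into U c) y, (g \<circ> inv_into U c) y))"
    by (intro smooth_on_Pair smooth_on_subset[OF N(4) _ o] smooth_on_subset[OF M(4) _ o]) auto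
  then show ?thesis
    by (intro smooth_nearI[OF U(1), of "M \<inter> N"]) (use N M in \<open>auto simp: o_def\<close>)
qed

lemma smooth_near_const: "smooth_near A p (\<lambda>x. k)"
proof -
  obtain U c where U: "(U, c) \<in> A" "p \<in> U" by (rule chart_at)
  show ?thesis
    by (rule smooth_nearI[OF U(1) chart_open(1)[OF U(1)]])
      (use U smooth_on_const chart_open(2)[OF U(1)] in \<open>auto simp: o_def\<close>)
qed

lemma smooth_near_chart: "(U, c) \<in> A \<Longrightarrow> p \<in> U \<Longrightarrow> smooth_near A p c"
  by (rule smooth_nearI[OF _ chart_open(1)])
    (auto intro!: smooth_on_cong[OF smooth_on_id] chart_open(2) simp: chart_inverse)

lemma smooth_near_add:
  fixes f g :: "'g \<Rightarrow> 'b::euclidean_space"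
  assumes "smooth_near A p f" "smooth_near A p g"
  shows "smooth_near A p (\<lambda>x. f x + g x)"
  using smooth_near_compose[OF smooth_near_Pair[OF assms], of UNIV "\<lambda>z. fst z + snd z"]
  by (simp add: smooth_on_add smooth_on_bounded_linear_compose[OF bounded_linear_fst smooth_on_id]
      smooth_on_bounded_linear_compose[OF bounded_linear_snd smooth_on_id])

lemma smooth_near_mult:
  fixes f g :: "'g \<Rightarrow> real"
  assumes "smooth_near A p f" "smooth_near A p g"
  shows "smooth_near A p (\<lambda>x. f x * g x)"
  using smooth_near_compose[OF smooth_near_Pair[OF assms], of UNIV "\<lambda>z. fst z * snd z"]
  by (simp add: smooth_on_mult smooth_on_bounded_linear_compose[OF bounded_linear_fst smooth_on_id]
      smooth_on_bounded_linear_compose[OF bounded_linear_snd smooth_on_id])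

lemma smooth_near_sum:
  fixes f :: "'i \<Rightarrow> 'g \<Rightarrow> 'b::euclidean_space"
  assumes "\<And>i. i \<in> I \<Longrightarrow> smooth_near A p (f i)"
  shows "smooth_near A p (\<lambda>x. \<Sum>i\<in>I. f i x)"
  using assms by (induction I rule: infinite_finite_induct) (auto intro: smooth_near_const smooth_near_add)

lemma smooth_near_inner:
  fixes f :: "'g \<Rightarrow> 'b::euclidean_space"
  assumes "smooth_near A p f"
  shows "smooth_near A p (\<lambda>x. f x \<bullet> b)"
  by (rule smooth_near_compose[OF assms, of UNIV "\<lambda>y. y \<bullet> b"])
    (simp_all add: smooth_on_bounded_linear_compose[OF bounded_linear_inner_left smooth_on_id])

section \<open>Tangent vectors and their calculus\<close>

lemma smooth_near_has_derivative:
  assumes "smooth_near A p f" "(U, c) \<in> A" "p \<in> U"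
  shows "(f \<circ> inv_into U c has_derivative frechet_derivative (f \<circ> inv_into U c) (at (c p))) (at (c p))"
  using smooth_nearE[OF assms] smooth_on_has_derivative by (metis imageI)

text \<open>The tangent vector with coordinates \<open>u\<close> in the chart, with the same default
  value 0 as in \<open>tangent_space\<close>, so that tangent vectors can be compared as plain
  functions.\<close>

definition chart_tangent :: "'g set \<Rightarrow> ('g \<Rightarrow> 'e) \<Rightarrow> 'g \<Rightarrow> 'e \<Rightarrow> 'g tangent" where
  "chart_tangent U c p u =
     (\<lambda>f. if smooth_near A p f then frechet_derivative (f \<circ> inv_into U c) (at (c p)) u else 0)"

lemma chart_tangent_mem: "(U, c) \<in> A \<Longrightarrow> p \<in> U \<Longrightarrow> chart_tangent U c p u \<in> tangent_space A p"
  unfolding tangent_space_def chart_tangent_def by auto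

lemma tangent_spaceE:
  assumes "v \<in> tangent_space A p"
  obtains U c u where "(U, c) \<in> A" "p \<in> U" "v = chart_tangent U c p u"
  using assms unfolding tangent_space_def chart_tangent_def by (auto simp: fun_eq_iff)

lemma tangent_nonsmooth: "v \<in> tangent_space A p \<Longrightarrow> \<not> smooth_near A p f \<Longrightarrow> v f = 0"
  by (elim tangent_spaceE) (simp add: chart_tangent_def)

lemma dir_deriv_chart_tangent:
  fixes \<phi> :: "'g \<Rightarrow> 'b::euclidean_space"
  assumes "(U, c) \<in> A" "p \<in> U" "smooth_near A p \<phi>"
  shows "dir_deriv (chart_tangent U c p u) \<phi> = frechet_derivative (\<phi> \<circ> inv_into U c) (at (c p)) u"
proof -
  let ?D = "frechet_derivative (\<phi> \<circ> inv_into U c) (at (c p))"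
  have "chart_tangent U c p u (\<lambda>q. \<phi> q \<bullet> b) = ?D u \<bullet> b" for b
  proof -
    have "((\<lambda>q. \<phi> q \<bullet> b) \<circ> inv_into U c has_derivative (\<lambda>u. ?D u \<bullet> b)) (at (c p))"
      using has_derivative_inner_left[OF smooth_near_has_derivative[OF assms(3,1,2)], of b]
      by (simp add: o_def)
    from frechet_derivative_at[OF this] show ?thesis
      unfolding chart_tangent_def using smooth_near_inner[OF assms(3)] by (metis (no_types, lifting))
  qed
  then show ?thesis unfolding dir_deriv_def by (simp add: euclidean_representation)
qed

text \<open>The chain rule in a chart around \<open>p\<close>. With \<open>\<phi>\<close> a pair of
  functions it gives the sum and product rules, and with \<open>\<phi>\<close> a chart the
  coordinate description of a tangent vector.\<close>

lemma tangent_chain: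
  fixes \<phi> :: "'g \<Rightarrow> 'b::euclidean_space"
  assumes v: "v \<in> tangent_space A p" and \<phi>: "smooth_near A p \<phi>"
    and H: "smooth_on S H" and S: "\<phi> p \<in> S"
  shows "v (\<lambda>x. H (\<phi> x)) = frechet_derivative H (at (\<phi> p)) (dir_deriv v \<phi>)"
proof -
  obtain U c u where U: "(U, c) \<in> A" "p \<in> U" and vu: "v = chart_tangent U c p u"
    using v by (rule tangent_spaceE)
  have "((\<lambda>x. H (\<phi> x)) \<circ> inv_into U c has_derivative frechet_derivative H (at (\<phi> p)) \<circ>
     frechet_derivative (\<phi> \<circ> inv_into U c) (at (c p))) (at (c p))"
    using diff_chain_at[OF smooth_near_has_derivative[OF \<phi> U], of H "frechet_derivative H (at (\<phi> p))"]
      smooth_on_has_derivative[OF H S] chart_inverse[OF U] by (simp add: o_def)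
  from frechet_derivative_at[OF this]
  have "frechet_derivative H (at (\<phi> p)) (dir_deriv v \<phi>)
      = frechet_derivative ((\<lambda>x. H (\<phi> x)) \<circ> inv_into U c) (at (c p)) u"
    unfolding vu dir_deriv_chart_tangent[OF U \<phi>] by (simp add: fun_eq_iff)
  then show ?thesis
    using smooth_near_compose[OF \<phi> H S] unfolding vu chart_tangent_def[of U c p u] by simp
qed

text \<open>Derivatives are local. If one of the functions fails to be smooth near \<open>p\<close>,
  so does the other, and both values are the default 0.\<close>

lemma tangent_cong:
  assumes v: "v \<in> tangent_space A p" and N: "open N" "p \<in> N" "\<And>x. x \<in> N \<Longrightarrow> f x = g x"
  shows "v f = v g"
proof (cases "smooth_near A p f")
  case True
  then have g: "smooth_near A p g" using smooth_near_cong N by blast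
  obtain U c u where U: "(U, c) \<in> A" "p \<in> U" and vu: "v = chart_tangent U c p u"
    using v by (rule tangent_spaceE)
  have o: "open (c ` (U \<inter> N))" by (rule open_chart_image[OF U(1)]) (use N chart_open[OF U(1)] in auto)
  have "frechet_derivative (f \<circ> inv_into U c) (at (c p)) = frechet_derivative (g \<circ> inv_into U c) (at (c p))"
    by (rule frechet_derivative_transform_within_open[OF _ o])
      (use smooth_near_has_derivative[OF True U] U N chart_inverse[OF U(1)] in \<open>auto simp: differentiable_def\<close>)
  then show ?thesis using True g vu by (simp add: chart_tangent_def)
next
  case False
  then have "\<not> smooth_near A p g" using smooth_near_cong[of p g N f] N by metis
  then show ?thesis using False tangent_nonsmooth[OF v] by simp
qed

text \<open>Membership in \<open>tangent_space\<close> refers to an unknown chart; here the chart is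
  arbitrary, and the coordinates of \<open>v\<close> in it turn out to be
  \<open>dir_deriv v c\<close>.\<close>

lemma tangent_chart_apply:
  assumes v: "v \<in> tangent_space A p" and U: "(U, c) \<in> A" "p \<in> U" and f: "smooth_near A p f"
  shows "v f = frechet_derivative (f \<circ> inv_into U c) (at (c p)) (dir_deriv v c)"
proof -
  obtain N where N: "open N" "p \<in> N" "N \<subseteq> U" "smooth_on (c ` N) (f \<circ> inv_into U c)"
    using smooth_nearE[OF f U] .
  have "v f = v (\<lambda>x. (f \<circ> inv_into U c) (c x))"
    by (rule tangent_cong[OF v chart_open(1)[OF U(1)] U(2)]) (simp add: chart_inverse[OF U(1)])
  also have "\<dots> = frechet_derivative (f \<circ> inv_into U c) (at (c p)) (dir_deriv v c)"
    by (rule tangent_chain[OF v smooth_near_chart[OF U] N(4)]) (use N in auto)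
  finally show ?thesis .
qed

lemma tangent_eq_chart_tangent:
  assumes "v \<in> tangent_space A p" "(U, c) \<in> A" "p \<in> U"
  shows "v = chart_tangent U c p (dir_deriv v c)"
  using tangent_chart_apply[OF assms] tangent_nonsmooth[OF assms(1)]
  by (auto simp: chart_tangent_def)

lemma dir_deriv_Pair:
  fixes \<phi> :: "'g \<Rightarrow> 'b::euclidean_space" and \<psi> :: "'g \<Rightarrow> 'c::euclidean_space"
  assumes "v \<in> tangent_space A p" "smooth_near A p \<phi>" "smooth_near A p \<psi>"
  shows "dir_deriv v (\<lambda>x. (\<phi> x, \<psi> x)) = (dir_deriv v \<phi>, dir_deriv v \<psi>)"
proof -
  obtain U c u where U: "(U, c) \<in> A" "p \<in> U" and vu: "v = chart_tangent U c p u"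
    using assms(1) by (rule tangent_spaceE)
  have "((\<lambda>x. (\<phi> x, \<psi> x)) \<circ> inv_into U c has_derivative
     (\<lambda>u. (frechet_derivative (\<phi> \<circ> inv_into U c) (at (c p)) u, frechet_derivative (\<psi> \<circ> inv_into U c) (at (c p)) u))) (at (c p))"
    using has_derivative_Pair[OF smooth_near_has_derivative[OF assms(2) U] smooth_near_has_derivative[OF assms(3) U]]
    by (simp add: o_def)
  from frechet_derivative_at[OF this, symmetric] show ?thesis
    unfolding vu dir_deriv_chart_tangent[OF U smooth_near_Pair[OF assms(2,3)]]
      dir_deriv_chart_tangent[OF U assms(2)] dir_deriv_chart_tangent[OF U assms(3)] by simp
qed

lemma dir_deriv_real: "dir_deriv v f = v f" for f :: "'g \<Rightarrow> real"
  by (simp add: dir_deriv_def)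

lemma tangent_const: "v \<in> tangent_space A p \<Longrightarrow> v (\<lambda>x. k) = 0"
  by (elim tangent_spaceE) (simp add: chart_tangent_def o_def)

lemma tangent_add:
  assumes "v \<in> tangent_space A p" "smooth_near A p f" "smooth_near A p g"
  shows "v (\<lambda>x. f x + g x) = v f + v g"
proof -
  have d: "((\<lambda>z. fst z + snd z) has_derivative (\<lambda>z. fst z + snd z)) (at x)" for x :: "real \<times> real"
    by (auto intro!: derivative_eq_intros)
  have "v (\<lambda>x. (\<lambda>z. fst z + snd z) (f x, g x)) = frechet_derivative (\<lambda>z. fst z + snd z) (at (f p, g p)) (v f, v g)"
    by (subst tangent_chain[OF assms(1) smooth_near_Pair[OF assms(2,3)], of UNIV "\<lambda>z. fst z + snd z"])
      (auto simp: dir_deriv_Pair[OF assms] dir_deriv_real intro!: smooth_on_add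
       smooth_on_bounded_linear_compose[OF bounded_linear_fst smooth_on_id]
      smooth_on_bounded_linear_compose[OF bounded_linear_snd smooth_on_id])
  then show ?thesis by (simp flip: frechet_derivative_at[OF d])
qed

lemma tangent_mult:
  assumes "v \<in> tangent_space A p" "smooth_near A p f" "smooth_near A p g"
  shows "v (\<lambda>x. f x * g x) = f p * v g + v f * g p"
proof -
  have d: "((\<lambda>z. fst z * snd z) has_derivative (\<lambda>z. fst x * snd z + fst z * snd x)) (at x)" for x :: "real \<times> real"
    by (auto intro!: derivative_eq_intros)
  have "v (\<lambda>x. (\<lambda>z. fst z * snd z) (f x, g x)) = frechet_derivative (\<lambda>z. fst z * snd z) (at (f p, g p)) (v f, v g)"
    by (subst tangent_chain[OF assms(1) smooth_near_Pair[OF assms(2,3)], of UNIV "\<lambda>z. fst z * snd z"])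
      (auto simp: dir_deriv_Pair[OF assms] dir_deriv_real intro!: smooth_on_mult
       smooth_on_bounded_linear_compose[OF bounded_linear_fst smooth_on_id]
      smooth_on_bounded_linear_compose[OF bounded_linear_snd smooth_on_id])
  then show ?thesis by (simp flip: frechet_derivative_at[OF d])
qed

lemma tangent_cmult:
  "v \<in> tangent_space A p \<Longrightarrow> smooth_near A p f \<Longrightarrow> v (\<lambda>x. k * f x) = k * v f"
  by (simp add: tangent_mult[OF _ smooth_near_const] tangent_const)

lemma tangent_sum:
  assumes "v \<in> tangent_space A p" "\<And>i. i \<in> I \<Longrightarrow> smooth_near A p (f i)"
  shows "v (\<lambda>x. \<Sum>i\<in>I. f i x) = (\<Sum>i\<in>I. v (f i))"
  using assms(2)
  by (induction I rule: infinite_finite_induct)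
    (auto simp: tangent_const[OF assms(1)] tangent_add[OF assms(1)] smooth_near_sum)

text \<open>The two vectors may be given in different charts; once both are written in a common
  chart, their coordinates combine linearly.\<close>

lemma tangent_space_combination:
  assumes v: "v \<in> tangent_space A p" and w: "w \<in> tangent_space A p"
  shows "(\<lambda>f. a * v f + b * w f) \<in> tangent_space A p"
proof -
  obtain U c where U: "(U, c) \<in> A" "p \<in> U" by (rule chart_at)
  have "(\<lambda>f. a * v f + b * w f) = chart_tangent U c p (a *\<^sub>R dir_deriv v c + b *\<^sub>R dir_deriv w c)"
  proof
    fix f
    show "a * v f + b * w f = chart_tangent U c p (a *\<^sub>R dir_deriv v c + b *\<^sub>R dir_deriv w c) f"
    proof (cases "smooth_near A p f")
      case True
      have "linear (frechet_derivative (f \<circ> inv_into U c) (at (c p)))"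
        using smooth_near_has_derivative[OF True U] has_derivative_linear by blast
      then show ?thesis
        using True tangent_chart_apply[OF v U True] tangent_chart_apply[OF w U True]
        by (simp add: chart_tangent_def linear_add linear_scale)
    qed (simp add: chart_tangent_def tangent_nonsmooth[OF v] tangent_nonsmooth[OF w])
  qed
  then show ?thesis using chart_tangent_mem[OF U] by simp
qed

lemma zero_in_tangent_space: "(\<lambda>f. 0) \<in> tangent_space A p"
proof -
  obtain U c where U: "(U, c) \<in> A" "p \<in> U" by (rule chart_at)
  show ?thesis
    using tangent_space_combination[OF chart_tangent_mem[OF U] chart_tangent_mem[OF U], of 0 _ 0] by simp
qed

lemma tangent_space_sum:
  assumes "\<And>i. i \<in> I \<Longrightarrow> v i \<in> tangent_space A p"
  shows "(\<lambda>f. \<Sum>i\<in>I. a i * v i f) \<in> tangent_space A p"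
  using assms
proof (induction I rule: infinite_finite_induct)
  case (insert i I)
  then show ?case
    using tangent_space_combination[of "v i" p "\<lambda>f. \<Sum>i\<in>I. a i * v i f" "a i" 1] by simp
qed (use zero_in_tangent_space in auto)

text \<open>In a chart the derivative of \<open>f\<close> vanishes on a ball, and a ball is
  convex.\<close>

lemma locally_constant_if_tangents_vanish:
  assumes N: "open N" "p \<in> N"
    and f: "\<And>q. q \<in> N \<Longrightarrow> smooth_near A q f"
    and z: "\<And>q v. q \<in> N \<Longrightarrow> v \<in> tangent_space A q \<Longrightarrow> v f = 0"
  obtains M where "open M" "p \<in> M" "\<And>q. q \<in> M \<Longrightarrow> f q = f p"
proof -
  obtain U c where U: "(U, c) \<in> A" "p \<in> U" by (rule chart_at)
  have "open (c ` (U \<inter> N))" by (rule open_chart_image[OF U(1)]) (use N chart_open[OF U(1)] in auto)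
  then obtain r where r: "r > 0" "ball (c p) r \<subseteq> c ` (U \<inter> N)"
    using U N open_contains_ball by blast
  have d: "(f \<circ> inv_into U c has_derivative (\<lambda>u. 0)) (at y)" if "y \<in> ball (c p) r" for y
  proof -
    have "y \<in> c ` (U \<inter> N)" using r that by blast
    then obtain q where q: "q \<in> U" "q \<in> N" "y = c q" by auto
    have "frechet_derivative (f \<circ> inv_into U c) (at (c q)) u = 0" for u
      using z[OF q(2) chart_tangent_mem[OF U(1) q(1)]] f[OF q(2)] by (simp add: chart_tangent_def)
    then show ?thesis
      using smooth_near_has_derivative[OF f[OF q(2)] U(1) q(1)] q(3) by presburger
  qed
  have *: "(f \<circ> inv_into U c) y = (f \<circ> inv_into U c) (c p)" if "y \<in> ball (c p) r" for y
  proof (rule has_derivative_zero_unique[of "ball (c p) r"])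
    show "(f \<circ> inv_into U c has_derivative (\<lambda>h. 0)) (at x within ball (c p) r)" if "x \<in> ball (c p) r" for x
      using d[OF that] by (rule has_derivative_at_withinI)
  qed (use that r(1) in auto)
  then have **: "f q = f p" if "q \<in> U" "c q \<in> ball (c p) r" for q
    using *[OF that(2)] chart_inverse[OF U(1) that(1)] chart_inverse[OF U] by simp
  show thesis
  proof (rule that[OF open_chart_preimage[OF U(1) open_ball]])
    show "p \<in> U \<inter> c -` ball (c p) r" using U r(1) by simp
    show "f q = f p" if "q \<in> U \<inter> c -` ball (c p) r" for q using ** that by blast
  qed
qed

text \<open>The map from coefficients to the chart coordinates of the combination is injective by
  \<open>indep\<close>; as source and target have equal dimension by \<open>dim\<close>, it is
  onto.\<close>

lemma tangent_space_spanned: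
  fixes e :: "'n::finite \<Rightarrow> 'g tangent"
  assumes dim: "CARD('n) = DIM('e)"
    and e: "\<And>i. e i \<in> tangent_space A p"
    and indep: "\<And>w. (\<And>f. (\<Sum>i\<in>UNIV. w i * e i f) = 0) \<Longrightarrow> w = (\<lambda>i. 0)"
    and v: "v \<in> tangent_space A p"
  obtains \<alpha> where "v = (\<lambda>f. \<Sum>i\<in>UNIV. \<alpha> i * e i f)"
proof -
  obtain U c where U: "(U, c) \<in> A" "p \<in> U" by (rule chart_at)
  define L where "L w = (\<Sum>i\<in>UNIV. (w $ i) *\<^sub>R dir_deriv (e i) c)" for w :: "real ^ 'n"
  have L: "linear L"
    unfolding L_def by (rule linearI) (simp_all add: algebra_simps sum.distrib scaleR_sum_right)
  have comb: "(\<Sum>i\<in>UNIV. w $ i * e i f) = chart_tangent U c p (L w) f" for w f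
  proof (cases "smooth_near A p f")
    case True
    have "linear (frechet_derivative (f \<circ> inv_into U c) (at (c p)))"
      using smooth_near_has_derivative[OF True U] has_derivative_linear by blast
    then show ?thesis
      using True tangent_chart_apply[OF e U True]
      by (simp add: chart_tangent_def L_def linear_sum linear_scale)
  qed (simp add: chart_tangent_def tangent_nonsmooth[OF e])
  have "inj L"
  proof (subst linear_injective_0[OF L], intro allI impI)
    fix w assume w: "L w = 0"
    have "chart_tangent U c p 0 f = 0" for f
      using smooth_near_has_derivative[OF _ U] has_derivative_linear linear_0
      by (fastforce simp: chart_tangent_def)
    then have "(\<lambda>i. w $ i) = (\<lambda>i. 0)" by (intro indep) (simp add: comb w)
    then show "w = 0" by (simp add: vec_eq_iff fun_eq_iff)
  qed
  then have "surj L" using linear_injective_imp_surjective[OF L] dim by simp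
  then obtain w where "L w = dir_deriv v c" by (metis surjD)
  then show thesis
    using that[of "\<lambda>i. w $ i"] comb tangent_eq_chart_tangent[OF v U] by simp
qed

end

section \<open>Lie groups\<close>

locale lie_group_manifold = manifold A
  for A :: "('g::{t2_space, second_countable_topology}, 'e::euclidean_space) atlas" +
  fixes G :: "'g monoid" (structure)
  assumes lie_group: "lie_group G A"
begin

sublocale group G
  using lie_group unfolding lie_group_def by blast

lemma carrier_UNIV [simp]: "carrier G = UNIV"
  using lie_group unfolding lie_group_def by blast

text \<open>The coordinate expression of \<open>f\<close> composed with multiplication, in product
  charts. The set \<open>W\<close> is at the disposal of the caller: taking a chart domain for it
  keeps the products inside that chart.\<close>

lemma mult_smooth_charts:
  fixes f :: "'g \<Rightarrow> 'b::real_normed_vector"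
  assumes f: "smooth_near A (p \<otimes> q) f" and U: "(U, c) \<in> A" "p \<in> U" and V: "(V, d) \<in> A" "q \<in> V"
    and W: "open W" "p \<otimes> q \<in> W"
  obtains S where "smooth_on S (\<lambda>z. f (inv_into U c (fst z) \<otimes> inv_into V d (snd z)))"
    "(c p, d q) \<in> S" "S \<subseteq> c ` U \<times> d ` V"
    "\<forall>z\<in>S. inv_into U c (fst z) \<otimes> inv_into V d (snd z) \<in> W"
proof -
  let ?m = "\<lambda>(x, y). x \<otimes> y"
  let ?M = "\<lambda>z. inv_into U c (fst z) \<otimes> inv_into V d (snd z)"
  obtain X b where X: "(X, b) \<in> A" "p \<otimes> q \<in> X" by (rule chart_at)
  obtain N where N: "open N" "p \<otimes> q \<in> N" "N \<subseteq> X" "smooth_on (b ` N) (f \<circ> inv_into X b)"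
    using smooth_nearE[OF f X] .
  define T where "T = map_prod c d ` ((U \<times> V) \<inter> ?m -` X)"
  have "smooth_map (prod_atlas A A) A ?m" using lie_group unfolding lie_group_def by blast
  moreover have "(U \<times> V, map_prod c d) \<in> prod_atlas A A" using U V unfolding prod_atlas_def by blast
  ultimately have s: "smooth_on T (b \<circ> ?m \<circ> inv_into (U \<times> V) (map_prod c d))"
    unfolding smooth_map_def T_def using X(1) by fast
  have inj: "inj_on (map_prod c d) (U \<times> V)"
    by (rule inj_on_inverseI[where g="map_prod (inv_into U c) (inv_into V d)"])
      (auto simp: chart_inverse[OF U(1)] chart_inverse[OF V(1)])
  have inv_eq: "inv_into (U \<times> V) (map_prod c d) (c x, d y) = (x, y)" if "x \<in> U" "y \<in> V" for x y
    using inv_into_f_f[OF inj, of "(x, y)"] that by simp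
  have s: "smooth_on T (\<lambda>z. b (?M z))"
    by (rule smooth_on_cong[OF s])
      (auto simp: T_def inv_eq chart_inverse[OF U(1)] chart_inverse[OF V(1)])
  \<comment> \<open>\<open>T\<close> is where the atlas grants smoothness of the multiplication. It
    is cut down so that products land in \<open>N\<close>, where \<open>f\<close> is smooth in the
    chart \<open>b\<close>, and in \<open>W\<close>.\<close>
  define S where "S = T \<inter> (\<lambda>z. b (?M z)) -` (b ` (N \<inter> W))"
  have MX: "?M z \<in> X" if "z \<in> T" for z
    using that by (auto simp: T_def chart_inverse[OF U(1)] chart_inverse[OF V(1)])
  have oS: "open S"
    unfolding S_def using N W
    by (intro continuous_open_preimage smooth_on_continuous[OF s] smooth_on_open[OF s]
        open_chart_image[OF X(1)]) auto
  have MN: "?M z \<in> N \<inter> W" if "z \<in> S" for z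
  proof -
    have "b (?M z) \<in> b ` (N \<inter> W)" "z \<in> T" using that unfolding S_def by simp_all
    then obtain y where y: "b (?M z) = b y" "y \<in> N \<inter> W" by (elim imageE)
    then have "?M z = y"
      using chart_inverse[OF X(1) MX[OF \<open>z \<in> T\<close>]] chart_inverse[OF X(1), of y] N(3) by auto
    then show ?thesis using y by simp
  qed
  have "smooth_on S ((f \<circ> inv_into X b) \<circ> (\<lambda>z. b (?M z)))"
  proof (rule smooth_on_compose[OF N(4) smooth_on_subset[OF s _ oS]])
    show "S \<subseteq> T" unfolding S_def by blast
    show "(\<lambda>z. b (?M z)) ` S \<subseteq> b ` N" using MN by blast
  qed
  then have "smooth_on S (\<lambda>z. f (?M z))"
    by (rule smooth_on_cong) (use MX in \<open>auto simp: S_def chart_inverse[OF X(1)]\<close>)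
  moreover have "(c p, d q) \<in> S"
    unfolding S_def T_def using U V X N W
    by (auto simp: chart_inverse[OF U(1)] chart_inverse[OF V(1)])
  moreover have "S \<subseteq> c ` U \<times> d ` V" unfolding S_def T_def by auto
  ultimately show thesis using that MN by blast
qed

text \<open>A chart carries no information outside its domain, so besides smoothness of
  \<open>c (F x)\<close> a whole neighbourhood of \<open>p\<close> has to be mapped into
  \<open>U\<close>. Together these yield continuity of \<open>F\<close> at \<open>p\<close>, see
  \<open>smooth_map_near_nbhd\<close>.\<close>

definition smooth_map_near :: "'g \<Rightarrow> ('g \<Rightarrow> 'g) \<Rightarrow> bool" where
  "smooth_map_near p F \<longleftrightarrow> (\<exists>U c N. (U, c) \<in> A \<and> open N \<and> p \<in> N \<and> F ` N \<subseteq> U \<and> smooth_near A p (\<lambda>x. c (F x)))"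

lemma smooth_near_compose_map:
  fixes f :: "'g \<Rightarrow> 'b::real_normed_vector"
  assumes "smooth_map_near p F" "smooth_near A (F p) f"
  shows "smooth_near A p (\<lambda>x. f (F x))"
proof -
  obtain U c N where U: "(U, c) \<in> A" "open N" "p \<in> N" "F ` N \<subseteq> U" and s: "smooth_near A p (\<lambda>x. c (F x))"
    using assms(1) unfolding smooth_map_near_def by blast
  obtain M where M: "open M" "F p \<in> M" "M \<subseteq> U" "smooth_on (c ` M) (f \<circ> inv_into U c)"
    using smooth_nearE[OF assms(2) U(1)] U by blast
  have "smooth_near A p (\<lambda>x. (f \<circ> inv_into U c) (c (F x)))"
    by (rule smooth_near_compose[OF s M(4)]) (use M in auto)
  then show ?thesis
    by (rule smooth_near_cong[OF _ U(2,3)]) (use U(4) in \<open>auto simp: chart_inverse[OF U(1)]\<close>)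
qed

lemma smooth_map_near_nbhd:
  assumes "smooth_map_near p F" "open W" "F p \<in> W"
  obtains N where "open N" "p \<in> N" "F ` N \<subseteq> W"
proof -
  obtain U c N where U: "(U, c) \<in> A" "open N" "p \<in> N" "F ` N \<subseteq> U" and s: "smooth_near A p (\<lambda>x. c (F x))"
    using assms(1) unfolding smooth_map_near_def by blast
  obtain M where M: "open M" "p \<in> M" "continuous_on M (\<lambda>x. c (F x))"
    using smooth_near_nbhd[OF s] by metis
  have o: "open (c ` (U \<inter> W))"
    by (rule open_chart_image[OF U(1)]) (use assms(2) chart_open[OF U(1)] in auto)
  let ?K = "N \<inter> (M \<inter> (\<lambda>x. c (F x)) -` (c ` (U \<inter> W)))"
  have "F x \<in> W" if "x \<in> ?K" for x
  proof -
    have "c (F x) \<in> c ` (U \<inter> W)" using that by simp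
    then obtain y where y: "c (F x) = c y" "y \<in> U \<inter> W" by (rule imageE)
    have "F x \<in> U" using U(4) that by auto
    then have "F x = y"
      using chart_inverse[OF U(1), of "F x"] chart_inverse[OF U(1), of y] y by simp
    then show ?thesis using y(2) by simp
  qed
  moreover have "open ?K" using continuous_open_preimage[OF M(3,1) o] U(2) by auto
  ultimately show thesis using that[of ?K] U M assms(3) by blast
qed

lemma smooth_map_nearI:
  assumes "open N" "p \<in> N" "F ` N \<subseteq> U" "(U, c) \<in> A" "smooth_near A p (\<lambda>x. c (F x))"
  shows "smooth_map_near p F"
  using assms unfolding smooth_map_near_def by blast

lemma smooth_map_near_id: "smooth_map_near p (\<lambda>x. x)"
proof -
  obtain U c where U: "(U, c) \<in> A" "p \<in> U" by (rule chart_at)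
  show ?thesis
    by (rule smooth_map_nearI[OF chart_open(1)[OF U(1)] U(2) _ U(1) smooth_near_chart[OF U]]) auto
qed

lemma smooth_map_near_const: "smooth_map_near p (\<lambda>x. k)"
proof -
  obtain U c where U: "(U, c) \<in> A" "k \<in> U" by (rule chart_at)
  show ?thesis
    by (rule smooth_map_nearI[OF open_UNIV _ _ U(1) smooth_near_const]) (use U in auto)
qed

lemma smooth_map_near_mult:
  assumes "smooth_map_near p F" "smooth_map_near p K"
  shows "smooth_map_near p (\<lambda>x. F x \<otimes> K x)"
proof -
  obtain U c where U: "(U, c) \<in> A" "F p \<in> U" by (rule chart_at)
  obtain V d where V: "(V, d) \<in> A" "K p \<in> V" by (rule chart_at)
  obtain W b where W: "(W, b) \<in> A" "F p \<otimes> K p \<in> W" by (rule chart_at)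
  obtain S where S: "smooth_on S (\<lambda>z. b (inv_into U c (fst z) \<otimes> inv_into V d (snd z)))"
    "(c (F p), d (K p)) \<in> S" "S \<subseteq> c ` U \<times> d ` V"
    "\<forall>z\<in>S. inv_into U c (fst z) \<otimes> inv_into V d (snd z) \<in> W"
    by (rule mult_smooth_charts[OF smooth_near_chart[OF W] U V chart_open(1)[OF W(1)] W(2)])
  have s: "smooth_near A p (\<lambda>x. (c (F x), d (K x)))"
    by (intro smooth_near_Pair smooth_near_compose_map[OF assms(1) smooth_near_chart[OF U]]
        smooth_near_compose_map[OF assms(2) smooth_near_chart[OF V]])
  obtain N1 where N1: "open N1" "p \<in> N1" "F ` N1 \<subseteq> U"
    using smooth_map_near_nbhd[OF assms(1) chart_open(1)[OF U(1)] U(2)] .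
  obtain N2 where N2: "open N2" "p \<in> N2" "K ` N2 \<subseteq> V"
    using smooth_map_near_nbhd[OF assms(2) chart_open(1)[OF V(1)] V(2)] .
  obtain N3 where N3: "open N3" "p \<in> N3" "continuous_on N3 (\<lambda>x. (c (F x), d (K x)))"
    using smooth_near_nbhd[OF s] by metis
  let ?N = "N1 \<inter> N2 \<inter> (N3 \<inter> (\<lambda>x. (c (F x), d (K x))) -` S)"
  have oN: "open ?N" using N1 N2 continuous_open_preimage[OF N3(3,1) smooth_on_open[OF S(1)]] by auto
  have pN: "p \<in> ?N" using N1 N2 N3 S(2) by auto
  have eq: "inv_into U c (c (F x)) \<otimes> inv_into V d (d (K x)) = F x \<otimes> K x" if "x \<in> N1 \<inter> N2" for x
    using that N1(3) N2(3) by (auto simp: chart_inverse[OF U(1)] chart_inverse[OF V(1)] image_subset_iff)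
  have "smooth_near A p (\<lambda>x. b (inv_into U c (c (F x)) \<otimes> inv_into V d (d (K x))))"
    using smooth_near_compose[OF s S(1) S(2)] by simp
  then have "smooth_near A p (\<lambda>x. b (F x \<otimes> K x))"
    by (rule smooth_near_cong[of _ _ "N1 \<inter> N2"]) (use N1 N2 eq in auto)
  moreover have "(\<lambda>x. F x \<otimes> K x) ` ?N \<subseteq> W"
    using S(4) eq by force
  ultimately show ?thesis using smooth_map_nearI[OF oN pN _ W(1)] by blast
qed

lemma smooth_map_near_inverse: "smooth_map_near p (\<lambda>x. inv\<^bsub>G\<^esub> x)"
proof -
  obtain U c where U: "(U, c) \<in> A" "p \<in> U" by (rule chart_at)
  obtain V d where V: "(V, d) \<in> A" "inv\<^bsub>G\<^esub> p \<in> V" by (rule chart_at)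
  have s: "smooth_map A A (\<lambda>x. inv\<^bsub>G\<^esub> x)" using lie_group unfolding lie_group_def by blast
  let ?N = "U \<inter> (\<lambda>x. inv\<^bsub>G\<^esub> x) -` V"
  have "open ((\<lambda>x. inv\<^bsub>G\<^esub> x) -` V)"
    using s chart_open(1)[OF V(1)] open_vimage unfolding smooth_map_def by blast
  then have oN: "open ?N" using chart_open(1)[OF U(1)] by blast
  have "smooth_on (c ` ?N) (d \<circ> (\<lambda>x. inv\<^bsub>G\<^esub> x) \<circ> inv_into U c)"
    using s U(1) V(1) unfolding smooth_map_def by fast
  then have "smooth_near A p (\<lambda>x. d (inv\<^bsub>G\<^esub> x))"
    by (intro smooth_nearI[OF U(1) oN]) (use U V in \<open>auto simp: o_def\<close>)
  then show ?thesis by (intro smooth_map_nearI[OF oN _ _ V(1)]) (use U V in auto)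
qed

lemma smooth_map_near_compose:
  assumes "smooth_map_near p F" "smooth_map_near (F p) K"
  shows "smooth_map_near p (\<lambda>x. K (F x))"
proof -
  obtain U c where U: "(U, c) \<in> A" "K (F p) \<in> U" by (rule chart_at)
  obtain M where M: "open M" "F p \<in> M" "K ` M \<subseteq> U"
    using smooth_map_near_nbhd[OF assms(2) chart_open(1)[OF U(1)] U(2)] .
  obtain N where N: "open N" "p \<in> N" "F ` N \<subseteq> M"
    using smooth_map_near_nbhd[OF assms(1) M(1,2)] .
  show ?thesis
    by (rule smooth_map_nearI[OF N(1,2) _ U(1) smooth_near_compose_map[OF assms(1)
            smooth_near_compose_map[OF assms(2) smooth_near_chart[OF U]]]])
      (use M N in auto)
qed

lemmas smooth_map_near_intros =
  smooth_map_near_id smooth_map_near_const smooth_map_near_mult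
  smooth_map_near_compose[OF _ smooth_map_near_inverse]

text \<open>On functions smooth near \<open>F p\<close> this is the chain rule. The assumption
  \<open>F'\<close> makes the push-forward take the default value 0 on all other functions;
  translations satisfy it because they have smooth inverses.\<close>

lemma tangent_push:
  assumes v: "v \<in> tangent_space A p" and F: "smooth_map_near p F"
    and F': "\<And>f :: 'g \<Rightarrow> real. smooth_near A p (\<lambda>x. f (F x)) \<Longrightarrow> smooth_near A (F p) f"
  shows "(\<lambda>f. v (\<lambda>x. f (F x))) \<in> tangent_space A (F p)"
proof -
  obtain W b where W: "(W, b) \<in> A" "F p \<in> W" by (rule chart_at)
  obtain M where M: "open M" "p \<in> M" "F ` M \<subseteq> W"
    using smooth_map_near_nbhd[OF F chart_open(1)[OF W(1)] W(2)] .
  have "v (\<lambda>x. f (F x)) = chart_tangent W b (F p) (dir_deriv v (\<lambda>x. b (F x))) f" for f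
  proof (cases "smooth_near A (F p) f")
    case True
    obtain N where N: "open N" "F p \<in> N" "N \<subseteq> W" "smooth_on (b ` N) (f \<circ> inv_into W b)"
      using smooth_nearE[OF True W] .
    have "v (\<lambda>x. f (F x)) = v (\<lambda>x. (f \<circ> inv_into W b) (b (F x)))"
      by (rule tangent_cong[OF v M(1,2)]) (use M(3) in \<open>auto simp: chart_inverse[OF W(1)]\<close>)
    also have "\<dots> = frechet_derivative (f \<circ> inv_into W b) (at (b (F p))) (dir_deriv v (\<lambda>x. b (F x)))"
      by (rule tangent_chain[OF v smooth_near_compose_map[OF F smooth_near_chart[OF W]] N(4)]) (use N in auto)
    finally show ?thesis using True by (simp add: chart_tangent_def)
  next
    case False
    then have "v (\<lambda>x. f (F x)) = 0" using F'[of f] tangent_nonsmooth[OF v, of "\<lambda>x. f (F x)"] by argo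
    then show ?thesis using False by (simp add: chart_tangent_def)
  qed
  then show ?thesis using chart_tangent_mem[OF W] by presburger
qed

lemma smooth_near_right_translation_iff:
  "smooth_near A p (\<lambda>y. f (y \<otimes> x)) \<longleftrightarrow> smooth_near A (p \<otimes> x) f"
proof
  assume a: "smooth_near A p (\<lambda>y. f (y \<otimes> x))"
  have "smooth_near A (p \<otimes> x) (\<lambda>z. (\<lambda>y. f (y \<otimes> x)) (z \<otimes> inv\<^bsub>G\<^esub> x))"
    by (rule smooth_near_compose_map, intro smooth_map_near_intros) (use a in \<open>simp add: m_assoc\<close>)
  then show "smooth_near A (p \<otimes> x) f" by (simp add: m_assoc)
next
  assume "smooth_near A (p \<otimes> x) f"
  then show "smooth_near A p (\<lambda>y. f (y \<otimes> x))"
    by (intro smooth_near_compose_map[of p "\<lambda>y. y \<otimes> x"] smooth_map_near_intros)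
qed

section \<open>Derivatives of products of group elements\<close>

lemma mixed_second_derivative:
  assumes v: "v \<in> tangent_space A p" and w: "w \<in> tangent_space A q" and f: "smooth_near A (p \<otimes> q) f"
  shows smooth_near_partial: "smooth_near A q (\<lambda>z. v (\<lambda>y. f (y \<otimes> z)))"
    and mixed_partials_commute: "w (\<lambda>z. v (\<lambda>y. f (y \<otimes> z))) = v (\<lambda>y. w (\<lambda>z. f (y \<otimes> z)))"
proof -
  obtain U c where U: "(U, c) \<in> A" "p \<in> U" by (rule chart_at)
  obtain V d where V: "(V, d) \<in> A" "q \<in> V" by (rule chart_at)
  \<comment> \<open>In charts \<open>f (y \<otimes> z)\<close> becomes one smooth function
    \<open>H\<close> of two variables, while \<open>v\<close> and \<open>w\<close> become
    derivatives in the directions \<open>(u, 0)\<close> and \<open>(0, t)\<close>. The claim is then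
    the symmetry of second derivatives of \<open>H\<close>.\<close>
  define H where "H = (\<lambda>z. f (inv_into U c (fst z) \<otimes> inv_into V d (snd z)))"
  obtain S where S: "smooth_on S H" "(c p, d q) \<in> S"
    by (rule mult_smooth_charts[OF f U V open_UNIV UNIV_I, folded H_def])
  define u t where "u = dir_deriv v c" and "t = dir_deriv w d"
  have H: "H (c y, d z) = f (y \<otimes> z)" if "y \<in> U" "z \<in> V" for y z
    using that by (simp add: H_def chart_inverse[OF U(1)] chart_inverse[OF V(1)])
  let ?D = "\<lambda>r z. frechet_derivative H (at z) r"
  have dv: "dir_deriv v (\<lambda>y. (c y, k :: 'e)) = (u, 0)" for k
    by (subst dir_deriv_Pair[OF v smooth_near_chart[OF U] smooth_near_const])
      (simp add: u_def dir_deriv_def tangent_const[OF v])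
  have dw: "dir_deriv w (\<lambda>y. (k :: 'e, d y)) = (0, t)" for k
    by (subst dir_deriv_Pair[OF w smooth_near_const smooth_near_chart[OF V]])
      (simp add: t_def dir_deriv_def tangent_const[OF w])
  have sv: "smooth_near A p (\<lambda>y. (c y, k :: 'e))" for k
    by (intro smooth_near_Pair smooth_near_chart[OF U] smooth_near_const)
  have sw: "smooth_near A q (\<lambda>y. (k :: 'e, d y))" for k
    by (intro smooth_near_Pair smooth_near_chart[OF V] smooth_near_const)
  have Dv: "v (\<lambda>y. f (y \<otimes> z)) = ?D (u, 0) (c p, d z)" if "z \<in> V" "(c p, d z) \<in> S" for z
  proof -
    have "v (\<lambda>y. f (y \<otimes> z)) = v (\<lambda>y. H (c y, d z))"
      by (rule tangent_cong[OF v chart_open(1)[OF U(1)] U(2)]) (simp add: H that)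
    also have "\<dots> = ?D (u, 0) (c p, d z)"
      using tangent_chain[OF v sv S(1), of "d z"] that dv by simp
    finally show ?thesis .
  qed
  have Dw: "w (\<lambda>z. f (y \<otimes> z)) = ?D (0, t) (c y, d q)" if "y \<in> U" "(c y, d q) \<in> S" for y
  proof -
    have "w (\<lambda>z. f (y \<otimes> z)) = w (\<lambda>z. H (c y, d z))"
      by (rule tangent_cong[OF w chart_open(1)[OF V(1)] V(2)]) (simp add: H that)
    also have "\<dots> = ?D (0, t) (c y, d q)"
      using tangent_chain[OF w sw S(1), of "c y"] that dw by simp
    finally show ?thesis .
  qed
  \<comment> \<open>The formula \<open>Dv\<close> only holds for those \<open>z\<close> whose chart
    point stays in \<open>S\<close>; these form a neighbourhood of \<open>q\<close>, which suffices
    because smoothness and tangent vectors are local. The set below plays the same part for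
    \<open>Dw\<close>.\<close>
  have oV: "open (V \<inter> d -` {y. (c p, y) \<in> S})"
    by (intro open_chart_preimage[OF V(1)])
      (use open_vimage[OF smooth_on_open[OF S(1)], of "\<lambda>y. (c p, y)"] in
        \<open>simp add: vimage_def continuous_on_Pair continuous_on_const continuous_on_id\<close>)
  have oU: "open (U \<inter> c -` {y. (y, d q) \<in> S})"
    by (intro open_chart_preimage[OF U(1)])
      (use open_vimage[OF smooth_on_open[OF S(1)], of "\<lambda>y. (y, d q)"] in
        \<open>simp add: vimage_def continuous_on_Pair continuous_on_const continuous_on_id\<close>)
  have sD: "smooth_on S (?D r)" for r by (rule smooth_on_frechet_derivative[OF S(1)])
  have "smooth_near A q (\<lambda>z. ?D (u, 0) (c p, d z))"
    by (rule smooth_near_compose[OF sw sD S(2)])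
  then show "smooth_near A q (\<lambda>z. v (\<lambda>y. f (y \<otimes> z)))"
    by (rule smooth_near_cong[OF _ oV]) (use V S(2) Dv in auto)
  have "w (\<lambda>z. v (\<lambda>y. f (y \<otimes> z))) = w (\<lambda>z. ?D (u, 0) (c p, d z))"
    by (rule tangent_cong[OF w oV]) (use V S(2) Dv in auto)
  also have "\<dots> = frechet_derivative (?D (u, 0)) (at (c p, d q)) (0, t)"
    using tangent_chain[OF w sw sD, of "c p" "(u, 0)"] S(2) dw by simp
  also have "\<dots> = frechet_derivative (?D (0, t)) (at (c p, d q)) (u, 0)"
    by (rule symmetric_second_derivative[OF S(1,2)])
  also have "\<dots> = v (\<lambda>y. ?D (0, t) (c y, d q))"
    using tangent_chain[OF v sv sD, of "d q" "(0, t)"] S(2) dv by simp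
  also have "\<dots> = v (\<lambda>y. w (\<lambda>z. f (y \<otimes> z)))"
    by (rule tangent_cong[OF v oU]) (use U S(2) Dw in auto)
  finally show "w (\<lambda>z. v (\<lambda>y. f (y \<otimes> z))) = v (\<lambda>y. w (\<lambda>z. f (y \<otimes> z)))" .
qed

text \<open>The derivative of the product in charts is a linear map applied to the pair of
  velocities of \<open>F\<close> and \<open>K\<close>, and such a pair is the sum of its two
  components.\<close>

lemma tangent_of_product:
  assumes v: "v \<in> tangent_space A p" and F: "smooth_map_near p F" and K: "smooth_map_near p K"
    and f: "smooth_near A (F p \<otimes> K p) f"
  shows "v (\<lambda>x. f (F x \<otimes> K x)) = v (\<lambda>x. f (F x \<otimes> K p)) + v (\<lambda>x. f (F p \<otimes> K x))"
proof -
  obtain U c where U: "(U, c) \<in> A" "F p \<in> U" by (rule chart_at)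
  obtain V d where V: "(V, d) \<in> A" "K p \<in> V" by (rule chart_at)
  define H where "H = (\<lambda>z. f (inv_into U c (fst z) \<otimes> inv_into V d (snd z)))"
  obtain S where S: "smooth_on S H" "(c (F p), d (K p)) \<in> S"
    by (rule mult_smooth_charts[OF f U V open_UNIV UNIV_I, folded H_def])
  \<comment> \<open>Stated for all maps with the values of \<open>F\<close> and \<open>K\<close> at
    \<open>p\<close>, so that it covers the pair itself and the two pairs in which one map is
    replaced by a constant.\<close>
  have chain: "v (\<lambda>x. f (F' x \<otimes> K' x)) =
      frechet_derivative H (at (c (F p), d (K p))) (dir_deriv v (\<lambda>x. c (F' x)), dir_deriv v (\<lambda>x. d (K' x)))"
    if F': "smooth_map_near p F'" "F' p = F p" and K': "smooth_map_near p K'" "K' p = K p" for F' K'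
  proof -
    obtain N1 where N1: "open N1" "p \<in> N1" "F' ` N1 \<subseteq> U"
      using smooth_map_near_nbhd[OF F'(1) chart_open(1)[OF U(1)]] U(2) F'(2) by metis
    obtain N2 where N2: "open N2" "p \<in> N2" "K' ` N2 \<subseteq> V"
      using smooth_map_near_nbhd[OF K'(1) chart_open(1)[OF V(1)]] V(2) K'(2) by metis
    have s1: "smooth_near A p (\<lambda>x. c (F' x))"
      by (rule smooth_near_compose_map[OF F'(1)]) (use smooth_near_chart U F'(2) in auto)
    have s2: "smooth_near A p (\<lambda>x. d (K' x))"
      by (rule smooth_near_compose_map[OF K'(1)]) (use smooth_near_chart V K'(2) in auto)
    have "v (\<lambda>x. f (F' x \<otimes> K' x)) = v (\<lambda>x. H (c (F' x), d (K' x)))"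
      by (rule tangent_cong[OF v, of "N1 \<inter> N2"])
        (use N1 N2 in \<open>auto simp: H_def chart_inverse[OF U(1)] chart_inverse[OF V(1)] image_subset_iff\<close>)
    then show ?thesis
      using tangent_chain[OF v smooth_near_Pair[OF s1 s2] S(1)] S(2) F'(2) K'(2) dir_deriv_Pair[OF v s1 s2] by simp
  qed
  have z: "dir_deriv v (\<lambda>x. k :: 'e) = 0" for k by (simp add: dir_deriv_def tangent_const[OF v])
  have l: "linear (frechet_derivative H (at (c (F p), d (K p))))"
    by (rule smooth_on_linear_frechet_derivative[OF S])
  show ?thesis
    by (subst (1 2 3) chain) (auto simp: F K smooth_map_near_const z simp flip: linear_add[OF l])
qed

end

section \<open>Traces of nilpotent operators\<close>

lemma nilpotent_orthonormal_basis_zero_diagonal: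
  fixes f :: "'a::euclidean_space \<Rightarrow> 'a"
  assumes f: "linear f" and nil: "\<And>x. (f ^^ k) x = 0"
    and V: "subspace V" "f ` V \<subseteq> V"
  shows "\<exists>B. finite B \<and> pairwise orthogonal B \<and> (\<forall>u\<in>B. norm u = 1 \<and> f u \<bullet> u = 0) \<and> span B = V"
  using V
proof (induction "dim V" arbitrary: V rule: less_induct)
  case less
  show ?case
  proof (cases "V = {0}")
    case True
    then show ?thesis by (intro exI[of _ "{}"]) auto
  next
    case False
    have "f ` V \<noteq> V"
    proof
      assume eq: "f ` V = V"
      have "(f ^^ n) ` V = V" for n
      proof (induction n)
        case (Suc n)
        have "(f ^^ Suc n) ` V = f ` ((f ^^ n) ` V)" by auto
        then show ?case using Suc eq by simp
      qed simp
      then have "V = (\<lambda>x. 0) ` V" using nil by (metis image_cong)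
      then show False using False subspace_0[OF less.prems(1)] by auto
    qed
    moreover have sp: "span (f ` V) = f ` V" "span V = V"
      using linear_subspace_image[OF f less.prems(1)] less.prems(1) by (simp_all only: span_eq_iff)
    ultimately have "span (f ` V) \<subset> span V" using less.prems(2) unfolding sp by blast
    then obtain y where y: "y \<noteq> 0" "y \<in> V" "\<And>x. x \<in> f ` V \<Longrightarrow> orthogonal y x"
      using orthogonal_to_subspace_exists_gen[of "f ` V" V] unfolding sp by blast
    define u where "u = (1 / norm y) *\<^sub>R y"
    have u: "norm u = 1" "u \<in> V" using y subspace_scale[OF less.prems(1)] by (auto simp: u_def)
    have uu: "u \<bullet> u = 1" using u(1) by (simp add: dot_square_norm)
    have ufV: "f x \<bullet> u = 0" if "x \<in> V" for x
      using y(3)[of "f x"] that by (simp add: u_def orthogonal_def inner_commute)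
    define V' where "V' = {v \<in> V. v \<bullet> u = 0}"
    have V': "subspace V'"
      using less.prems(1) unfolding V'_def subspace_def by (auto simp: inner_simps)
    have "V' \<subset> V" using uu u(2) unfolding V'_def by force
    then have "dim V' < dim V"
      using V' less.prems(1) by (metis dim_subset psubset_eq subspace_dim_equal order_le_less)
    moreover have "f ` V' \<subseteq> V'" using ufV less.prems(2) unfolding V'_def by auto
    ultimately obtain B where B: "finite B" "pairwise orthogonal B" "\<And>u. u \<in> B \<Longrightarrow> norm u = 1 \<and> f u \<bullet> u = 0" "span B = V'"
      using less.hyps[OF _ V'] by blast
    have BV: "b \<bullet> u = 0" if "b \<in> B" for b
      using B(4) span_superset[of B] that unfolding V'_def by auto
    have "span (insert u B) = V"
    proof
      have "insert u B \<subseteq> V" using u(2) B(4) span_superset[of B] \<open>V' \<subset> V\<close> by auto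
      then show "span (insert u B) \<subseteq> V" using span_minimal less.prems(1) by blast
      show "V \<subseteq> span (insert u B)"
      proof
        fix v assume v: "v \<in> V"
        have "v - (v \<bullet> u) *\<^sub>R u \<in> V'"
          using v u(2) less.prems(1) uu unfolding V'_def
          by (auto simp: inner_simps intro: subspace_diff subspace_scale)
        then show "v \<in> span (insert u B)" using B(4) by (auto simp: span_insert)
      qed
    qed
    moreover have "pairwise orthogonal (insert u B)"
      using B(2) BV by (auto simp: pairwise_insert orthogonal_def inner_commute)
    ultimately show ?thesis
      using B u ufV by (intro exI[of _ "insert u B"]) auto
  qed
qed

text \<open>The trace may be computed in any orthonormal basis, in particular in one with zero
  diagonal.\<close>

lemma trace_nilpotent:
  fixes f :: "'a::euclidean_space \<Rightarrow> 'a"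
  assumes f: "linear f" and nil: "\<And>x. (f ^^ k) x = 0"
  shows "(\<Sum>b\<in>Basis. f b \<bullet> b) = 0"
proof -
  obtain B where B: "finite B" "pairwise orthogonal B" "\<And>u. u \<in> B \<Longrightarrow> norm u = 1 \<and> f u \<bullet> u = 0" "span B = (UNIV :: 'a set)"
    using nilpotent_orthonormal_basis_zero_diagonal[OF f nil, of UNIV] by auto
  have ex: "x = (\<Sum>u\<in>B. (x \<bullet> u) *\<^sub>R u)" for x
    using orthonormal_basis_expand[of B x] B by (auto simp: inner_commute)
  have "(\<Sum>b\<in>Basis. f b \<bullet> b) = (\<Sum>b\<in>Basis. \<Sum>u\<in>B. (f b \<bullet> u) * (u \<bullet> b))"
    by (subst ex) (simp add: inner_sum_left)
  also have "\<dots> = (\<Sum>u\<in>B. \<Sum>b\<in>Basis. (u \<bullet> b) * (f b \<bullet> u))"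
    by (subst sum.swap) (simp add: mult.commute)
  also have "\<dots> = (\<Sum>u\<in>B. f (\<Sum>b\<in>Basis. (u \<bullet> b) *\<^sub>R b) \<bullet> u)"
    by (simp add: linear_sum[OF f] linear_scale[OF f] inner_sum_left)
  also have "\<dots> = 0" using B(3) by (simp add: euclidean_representation)
  finally show ?thesis .
qed

section \<open>Left-invariant frames\<close>

locale lie_group_frame = lie_group_manifold A G
  for A :: "('g::{t2_space, second_countable_topology}, real ^ 'n::finite) atlas"
    and G :: "'g monoid" (structure) +
  fixes g :: "'g \<Rightarrow> 'g tangent \<Rightarrow> 'g tangent \<Rightarrow> real"
    and nabla :: "'g vfield \<Rightarrow> 'g vfield \<Rightarrow> 'g vfield"
    and e :: "'n \<Rightarrow> 'g vfield"
  assumes riemannian: "riemannian_metric A g"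
    and levi_civita: "levi_civita_connection A g nabla"
    and frame: "left_invariant_orthonormal_frame G A g e"
begin

section \<open>Expansion of tangent vectors in the frame\<close>

lemma frame_vfield: "smooth_vfield A (e i)"
  using frame unfolding left_invariant_orthonormal_frame_def by blast

lemma frame_tangent: "e i p \<in> tangent_space A p"
  using frame_vfield unfolding smooth_vfield_def by blast

lemma frame_smooth: "smooth_near A p f \<Longrightarrow> smooth_near A p (\<lambda>q. e i q f)"
  using frame_vfield unfolding smooth_vfield_def by blast

lemma frame_left: "e i (a \<otimes> p) f = e i p (\<lambda>x. f (a \<otimes> x))"
  using frame unfolding left_invariant_orthonormal_frame_def left_invariant_vfield_def push_left_def
  by metis

lemma frame_orthonormal: "g p (e i p) (e j p) = (if i = j then 1 else 0)"
  using frame unfolding left_invariant_orthonormal_frame_def by blast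

lemma metric_combination:
  "u \<in> tangent_space A p \<Longrightarrow> v \<in> tangent_space A p \<Longrightarrow> w \<in> tangent_space A p \<Longrightarrow>
     g p (\<lambda>f. a * u f + b * v f) w = a * g p u w + b * g p v w"
  using riemannian unfolding riemannian_metric_def by blast

lemma metric_commute:
  "v \<in> tangent_space A p \<Longrightarrow> w \<in> tangent_space A p \<Longrightarrow> g p v w = g p w v"
  using riemannian unfolding riemannian_metric_def by blast

lemma metric_zero: "w \<in> tangent_space A p \<Longrightarrow> g p (\<lambda>f. 0) w = 0"
  using metric_combination[of "\<lambda>f. 0" p "\<lambda>f. 0" w 0 0] zero_in_tangent_space by simp

lemma metric_sum:
  assumes "\<And>i. i \<in> I \<Longrightarrow> v i \<in> tangent_space A p" "w \<in> tangent_space A p"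
  shows "g p (\<lambda>f. \<Sum>i\<in>I. a i * v i f) w = (\<Sum>i\<in>I. a i * g p (v i) w)"
  using assms(1)
proof (induction I rule: infinite_finite_induct)
  case (insert i I)
  then show ?case
    using metric_combination[OF _ tangent_space_sum[of I v p a] assms(2), of "v i" "a i" 1] by simp
qed (use metric_zero[OF assms(2)] in auto)

lemma frame_coefficient:
  assumes "\<And>f. (\<Sum>i\<in>UNIV. a i * e i p f) = v f"
  shows "g p v (e j p) = a j"
proof -
  have "v = (\<lambda>f. \<Sum>i\<in>UNIV. a i * e i p f)" using assms by (simp add: fun_eq_iff)
  then have "g p v (e j p) = (\<Sum>i\<in>UNIV. a i * g p (e i p) (e j p))"
    using metric_sum[of UNIV "\<lambda>i. e i p" p "e j p" a] frame_tangent by simp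
  also have "\<dots> = a j" by (simp add: frame_orthonormal if_distrib cong: if_cong)
  finally show ?thesis .
qed

lemma frame_independent:
  assumes "\<And>f. (\<Sum>i\<in>UNIV. a i * e i p f) = 0"
  shows "a = (\<lambda>i. 0)"
  using frame_coefficient[of a p "\<lambda>f. 0"] assms metric_zero[OF frame_tangent] by (auto simp: fun_eq_iff)

lemma frame_expansion:
  assumes "v \<in> tangent_space A p"
  shows "v f = (\<Sum>i\<in>UNIV. g p v (e i p) * e i p f)"
proof -
  obtain \<alpha> where a: "v = (\<lambda>f. \<Sum>i\<in>UNIV. \<alpha> i * e i p f)"
    by (rule tangent_space_spanned[of "\<lambda>i. e i p", OF _ frame_tangent frame_independent assms]) auto
  show ?thesis using frame_coefficient[of \<alpha> p v] a by simp
qed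

section \<open>Brackets of the frame fields\<close>

lemma smooth_near_left_translation:
  fixes f :: "'g \<Rightarrow> 'b::real_normed_vector"
  shows "smooth_near A (a \<otimes> p) f \<Longrightarrow> smooth_near A p (\<lambda>x. f (a \<otimes> x))"
  by (intro smooth_near_compose_map[of p "\<lambda>x. a \<otimes> x"] smooth_map_near_intros)

text \<open>The Levi-Civita connection is torsion free, which makes the bracket a vector field.\<close>

lemma bracket_tangent:
  assumes "smooth_vfield A X" "smooth_vfield A Y"
  shows "lie_bracket A X Y p \<in> tangent_space A p"
proof -
  have eq: "(\<lambda>p f. nabla X Y p f - nabla Y X p f) = lie_bracket A X Y"
    and s: "smooth_vfield A (nabla X Y)" "smooth_vfield A (nabla Y X)"
    using levi_civita[unfolded levi_civita_connection_def, THEN conjunct2, THEN conjunct1] assms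
      levi_civita[unfolded levi_civita_connection_def affine_connection_def, THEN conjunct1, THEN conjunct1]
    by blast+
  have "(\<lambda>f. 1 * nabla X Y p f + (-1) * nabla Y X p f) \<in> tangent_space A p"
    using s unfolding smooth_vfield_def by (intro tangent_space_combination) auto
  then show ?thesis by (simp flip: eq)
qed

definition structure_constant :: "'n \<Rightarrow> 'n \<Rightarrow> 'n \<Rightarrow> real" where
  "structure_constant i j k = g \<one> (lie_bracket A (e i) (e j) \<one>) (e k \<one>)"

text \<open>The bracket of left-invariant fields is left-invariant, so its value at \<open>p\<close>
  is read off at the identity, where the structure constants are defined.\<close>

lemma frame_bracket:
  "lie_bracket A (e i) (e j) p f = (\<Sum>k\<in>UNIV. structure_constant i j k * e k p f)"
proof (cases "smooth_near A p f")
  case True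
  have s: "smooth_near A \<one> (\<lambda>x. f (p \<otimes> x))"
    by (rule smooth_near_left_translation) (use True in simp)
  have one: "e i p f = e i \<one> (\<lambda>x. f (p \<otimes> x))" for i f
    using frame_left[of i p "\<one>" f] by simp
  have "lie_bracket A (e i) (e j) p f = lie_bracket A (e i) (e j) \<one> (\<lambda>x. f (p \<otimes> x))"
    using True s unfolding lie_bracket_def by (simp add: one[of _ "\<lambda>q. e _ q f"] frame_left)
  also have "\<dots> = (\<Sum>k\<in>UNIV. structure_constant i j k * e k \<one> (\<lambda>x. f (p \<otimes> x)))"
    unfolding structure_constant_def
    by (rule frame_expansion[OF bracket_tangent[OF frame_vfield frame_vfield]])
  finally show ?thesis by (simp flip: one)
next
  case False
  then show ?thesis using tangent_nonsmooth[OF frame_tangent] by (simp add: lie_bracket_def)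
qed

section \<open>Right-invariant fields and the adjoint matrices\<close>

definition right_field :: "'n \<Rightarrow> 'g vfield" where
  "right_field l = (\<lambda>x f. e l \<one> (\<lambda>y. f (y \<otimes> x)))"

lemma right_field_one: "right_field l \<one> = e l \<one>"
  by (simp add: right_field_def)

text \<open>The value at \<open>p\<close> is the push-forward of \<open>e l \<one>\<close> under
  right translation by \<open>p\<close>. Smooth dependence on \<open>p\<close> holds because a
  partial derivative of \<open>f (y \<otimes> q)\<close> in \<open>y\<close> is smooth in
  \<open>q\<close>.\<close>

lemma right_field_vfield: "smooth_vfield A (right_field l)"
proof -
  have "right_field l p \<in> tangent_space A p" for p
  proof -
    have "(\<lambda>f. e l \<one> (\<lambda>y. f (y \<otimes> p))) \<in> tangent_space A (\<one> \<otimes> p)"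
      by (rule tangent_push[OF frame_tangent]) (intro smooth_map_near_intros, simp only: smooth_near_right_translation_iff)
    then show ?thesis by (simp add: right_field_def)
  qed
  moreover have "smooth_near A p (\<lambda>q. right_field l q f)" if "smooth_near A p f" for p f
    unfolding right_field_def by (rule smooth_near_partial[OF frame_tangent frame_tangent]) (use that in simp)
  ultimately show ?thesis unfolding smooth_vfield_def by blast
qed

text \<open>Left invariance lets \<open>e i\<close> act on \<open>z\<close> alone in
  \<open>f (y \<otimes> z)\<close>, while \<open>right_field l\<close> acts on \<open>y\<close>
  alone. Both sides are mixed second derivatives at \<open>(\<one>, p)\<close>.\<close>

lemma frame_right_field_commute:
  assumes "smooth_near A p f"
  shows "e i p (\<lambda>q. right_field l q f) = right_field l p (\<lambda>q. e i q f)"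
  unfolding right_field_def frame_left
  by (rule mixed_partials_commute[OF frame_tangent frame_tangent]) (use assms in simp)

text \<open>\<open>right_coeff j l x\<close> are the matrix entries of \<open>Ad(x\<^sup>-\<^sup>1)\<close>.\<close>

definition right_coeff :: "'n \<Rightarrow> 'n \<Rightarrow> 'g \<Rightarrow> real" where
  "right_coeff j l x = g x (right_field l x) (e j x)"

lemma right_field_tangent: "right_field l x \<in> tangent_space A x"
  using right_field_vfield unfolding smooth_vfield_def by blast

lemma right_field_expansion: "right_field l x f = (\<Sum>j\<in>UNIV. right_coeff j l x * e j x f)"
  unfolding right_coeff_def by (rule frame_expansion[OF right_field_tangent])

lemma right_coeff_smooth: "smooth_near A p (right_coeff j l)"
  using riemannian right_field_vfield frame_vfield
  unfolding riemannian_metric_def smooth_fun_def right_coeff_def[abs_def] by blast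

lemma right_coeff_one: "right_coeff j l \<one> = (if j = l then 1 else 0)"
  unfolding right_coeff_def right_field_one frame_orthonormal by auto

text \<open>Comes from \<open>[e\<^sub>i, r\<^sub>l] = 0\<close>, as left and right translations commute.\<close>

lemma frame_right_coeff:
  "e i p (right_coeff k l) = - (\<Sum>j\<in>UNIV. structure_constant i j k * right_coeff j l p)"
proof -
  let ?a = "right_coeff" and ?C = structure_constant
  \<comment> \<open>The coefficient of \<open>e k\<close> in the bracket of \<open>e i\<close> with
    \<open>right_field l\<close>, by the Leibniz rule. The bracket vanishes, so independence of the
    frame makes every coefficient 0.\<close>
  define w where "w k = e i p (?a k l) + (\<Sum>j\<in>UNIV. ?C i j k * ?a j l p)" for k
  have "(\<Sum>k\<in>UNIV. w k * e k p f) = 0" for f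
  proof (cases "smooth_near A p f")
    case True
    have "e i p (\<lambda>q. right_field l q f) = (\<Sum>j\<in>UNIV. e i p (\<lambda>q. ?a j l q * e j q f))"
      unfolding right_field_expansion
      by (intro tangent_sum[OF frame_tangent] smooth_near_mult right_coeff_smooth frame_smooth True)
    also have "\<dots> = (\<Sum>j\<in>UNIV. ?a j l p * e i p (\<lambda>q. e j q f) + e i p (?a j l) * e j p f)"
      by (intro sum.cong refl tangent_mult[OF frame_tangent] right_coeff_smooth frame_smooth True)
    finally have 1: "e i p (\<lambda>q. right_field l q f) =
      (\<Sum>j\<in>UNIV. ?a j l p * e i p (\<lambda>q. e j q f) + e i p (?a j l) * e j p f)" .
    have "(\<Sum>j\<in>UNIV. ?a j l p * e j p (\<lambda>q. e i q f)) = right_field l p (\<lambda>q. e i q f)"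
      by (simp add: right_field_expansion)
    also have "\<dots> = (\<Sum>j\<in>UNIV. ?a j l p * e i p (\<lambda>q. e j q f) + e i p (?a j l) * e j p f)"
      using frame_right_field_commute[OF True] 1 by simp
    finally have "(\<Sum>j\<in>UNIV. ?a j l p * lie_bracket A (e i) (e j) p f + e i p (?a j l) * e j p f) = 0"
      using True by (simp add: lie_bracket_def sum.distrib sum_subtractf algebra_simps)
    moreover have "(\<Sum>j\<in>UNIV. ?a j l p * lie_bracket A (e i) (e j) p f) =
       (\<Sum>k\<in>UNIV. (\<Sum>j\<in>UNIV. ?C i j k * ?a j l p) * e k p f)"
      unfolding frame_bracket sum_distrib_left sum_distrib_right
      by (subst sum.swap) (simp add: mult_ac)
    ultimately show ?thesis by (simp add: w_def sum.distrib algebra_simps)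
  qed (simp add: tangent_nonsmooth[OF frame_tangent])
  then have "w = (\<lambda>i. 0)" by (rule frame_independent)
  then show ?thesis unfolding w_def fun_eq_iff by (metis add.commute add_eq_0_iff)
qed

section \<open>Differentials of commutator maps\<close>

definition commutator_map :: "'g \<Rightarrow> 'g \<Rightarrow> 'g" where
  "commutator_map x y = inv\<^bsub>G\<^esub> x \<otimes> y \<otimes> x \<otimes> inv\<^bsub>G\<^esub> y"

lemma smooth_commutator_map: "smooth_map_near p (commutator_map x)"
  unfolding commutator_map_def[abs_def]
  by (intro smooth_map_near_mult smooth_map_near_const smooth_map_near_id smooth_map_near_inverse)

lemma commutator_map_one [simp]: "commutator_map x \<one> = \<one>"
  by (simp add: commutator_map_def)

definition Ad_minus_id :: "'g \<Rightarrow> real ^ 'n \<Rightarrow> real ^ 'n" where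
  "Ad_minus_id x w = (\<chi> j. (\<Sum>l\<in>UNIV. right_coeff j l x * w $ l) - w $ j)"

text \<open>Multiplying \<open>commutator_map x y\<close> by \<open>y\<close> on the right gives the
  conjugate of \<open>y\<close> by the inverse of \<open>x\<close>, whose differential at the
  identity has the matrix \<open>right_coeff\<close>. By the product rule the extra factor
  \<open>y\<close> contributes the identity map, which is subtracted.\<close>

lemma tangent_commutator_map:
  assumes h: "smooth_near A \<one> h"
  shows "(\<Sum>l\<in>UNIV. w $ l * e l \<one> (\<lambda>y. h (commutator_map x y))) =
     (\<Sum>j\<in>UNIV. Ad_minus_id x w $ j * e j \<one> h)"
proof -
  have "e l \<one> (\<lambda>y. h (commutator_map x y)) = (\<Sum>j\<in>UNIV. right_coeff j l x * e j \<one> h) - e l \<one> h" for l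
  proof -
    \<comment> \<open>Translating \<open>h\<close> by the inverse of \<open>x\<close> turns the
      derivative at the identity into one at \<open>x\<close>, where \<open>right_field\<close> is
      expanded in the frame.\<close>
    let ?f = "\<lambda>z. h (inv\<^bsub>G\<^esub> x \<otimes> z)"
    have e1: "e j x ?f = e j \<one> h" for j
      using frame_left[of j x "\<one>" ?f] by (simp flip: m_assoc)
    have "e l \<one> (\<lambda>y. h (commutator_map x y \<otimes> y)) = right_field l x ?f"
      by (simp add: right_field_def commutator_map_def m_assoc)
    also have "\<dots> = (\<Sum>j\<in>UNIV. right_coeff j l x * e j \<one> h)"
      by (simp add: right_field_expansion e1)
    finally show ?thesis
      using tangent_of_product[OF frame_tangent smooth_commutator_map[of "\<one>" x] smooth_map_near_id, of h l] h
      by simp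
  qed
  then have "(\<Sum>l\<in>UNIV. w $ l * e l \<one> (\<lambda>y. h (commutator_map x y))) =
      (\<Sum>l\<in>UNIV. \<Sum>j\<in>UNIV. w $ l * (right_coeff j l x * e j \<one> h)) - (\<Sum>l\<in>UNIV. w $ l * e l \<one> h)"
    by (simp add: right_diff_distrib sum_subtractf sum_distrib_left)
  also have "(\<Sum>l\<in>UNIV. \<Sum>j\<in>UNIV. w $ l * (right_coeff j l x * e j \<one> h)) =
      (\<Sum>j\<in>UNIV. (\<Sum>l\<in>UNIV. right_coeff j l x * w $ l) * e j \<one> h)"
    by (subst sum.swap) (simp add: sum_distrib_right sum_distrib_left mult_ac)
  finally show ?thesis
    by (simp add: Ad_minus_id_def left_diff_distrib sum_subtractf)
qed

text \<open>\<open>commutator_map x z\<close> is the commutator of the inverse of \<open>x\<close>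
  with \<open>z\<close>, hence one of the generators of the next term of the series.\<close>

lemma iterated_commutator_mem: "foldr commutator_map xs y \<in> lower_central_series G (length xs)"
proof (induction xs)
  case (Cons x xs)
  let ?z = "foldr commutator_map xs y"
  have "commutator_map x ?z = inv\<^bsub>G\<^esub> x \<otimes> ?z \<otimes> inv\<^bsub>G\<^esub> (inv\<^bsub>G\<^esub> x) \<otimes> inv\<^bsub>G\<^esub> ?z"
    by (simp add: commutator_map_def)
  then have "commutator_map x ?z \<in> {x \<otimes> y \<otimes> inv\<^bsub>G\<^esub> x \<otimes> inv\<^bsub>G\<^esub> y | x y.
       x \<in> carrier G \<and> y \<in> lower_central_series G (length xs)}"
    using Cons.IH by (intro CollectI exI[of _ "inv\<^bsub>G\<^esub> x"] exI[of _ ?z]) simp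
  then show ?case by (auto intro: generate.incl)
qed simp

text \<open>Every commutator map fixes the identity, so the differentials there compose in the same
  order as the maps.\<close>

lemma tangent_iterated_commutator:
  assumes "smooth_near A \<one> h"
  shows "(\<Sum>l\<in>UNIV. w $ l * e l \<one> (\<lambda>y. h (foldr commutator_map xs y))) =
     (\<Sum>j\<in>UNIV. foldr Ad_minus_id xs w $ j * e j \<one> h)"
  using assms
proof (induction xs arbitrary: h)
  case (Cons x xs)
  have "smooth_near A \<one> (\<lambda>y. h (commutator_map x y))"
    by (rule smooth_near_compose_map[OF smooth_commutator_map]) (simp add: Cons.prems)
  from Cons.IH[OF this] show ?case
    by (simp add: tangent_commutator_map[OF Cons.prems])
qed simp

text \<open>The \<open>k\<close>-fold commutator map is constant, so its differential is 0, and
  independence of the frame isolates the coordinates.\<close>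

lemma Ad_unipotent:
  assumes "lower_central_series G k = {\<one>}" "length xs = k"
  shows "foldr Ad_minus_id xs w = 0"
proof -
  have c: "foldr commutator_map xs y = \<one>" for y
    using iterated_commutator_mem[of xs y] assms by simp
  have "(\<Sum>j\<in>UNIV. foldr Ad_minus_id xs w $ j * e j \<one> h) = 0" for h
  proof (cases "smooth_near A \<one> h")
    case True
    show ?thesis
      using tangent_iterated_commutator[OF True, of w xs] c tangent_const[OF frame_tangent] by simp
  qed (simp add: tangent_nonsmooth[OF frame_tangent])
  then have "(\<lambda>j. foldr Ad_minus_id xs w $ j) = (\<lambda>j. 0)" by (rule frame_independent)
  then show ?thesis by (simp add: vec_eq_iff fun_eq_iff)
qed

section \<open>Nilpotency of the adjoint operators\<close>

definition ad :: "'n \<Rightarrow> real ^ 'n \<Rightarrow> real ^ 'n" where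
  "ad m w = (\<chi> k. \<Sum>j\<in>UNIV. structure_constant m j k * w $ j)"

lemma linear_ad: "linear (ad m)"
  unfolding ad_def
  by (rule linearI) (simp_all add: vec_eq_iff algebra_simps sum.distrib sum_distrib_left)

lemma linear_foldr_ad: "linear (foldr ad ms)"
proof (induction ms)
  case (Cons m ms)
  then show ?case using linear_compose[OF Cons.IH linear_ad] by (simp add: o_def)
qed (simp add: linear_iff)

text \<open>The assumption is differentiated in \<open>x\<close> at the identity along
  \<open>e m\<close>. Since \<open>right_coeff\<close> is the unit matrix there,
  \<open>frame_right_coeff\<close> shows that the derivative of \<open>Ad_minus_id x w\<close> is
  \<open>- ad m w\<close>.\<close>

lemma linear_ad_eq_0_if_Ad:
  assumes T: "linear T" and z: "\<And>x. T (Ad_minus_id x w) = (0 :: real ^ 'n)"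
  shows "T (ad m w) = 0"
proof -
  \<comment> \<open>Tangent vectors act on real functions only, so \<open>T\<close> is written out
    by its columns before differentiating.\<close>
  have T_sum: "T u = (\<Sum>i\<in>UNIV. (u $ i) *\<^sub>R T (axis i 1))" for u
  proof -
    have "T u = T (\<Sum>i\<in>UNIV. (u $ i) *\<^sub>R axis i 1)"
      using basis_expansion[of u] by (simp add: scalar_mult_eq_scaleR)
    then show ?thesis by (simp add: linear_sum[OF T] linear_scale[OF T])
  qed
  have s: "smooth_near A \<one> (\<lambda>x. \<Sum>l\<in>UNIV. w $ l * right_coeff i l x)" for i
    by (intro smooth_near_sum smooth_near_mult smooth_near_const right_coeff_smooth)
  have eq: "Ad_minus_id x w $ i = (\<Sum>l\<in>UNIV. w $ l * right_coeff i l x) + - (w $ i)" for x i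
    by (simp add: Ad_minus_id_def mult.commute)
  have d: "e m \<one> (\<lambda>x. Ad_minus_id x w $ i) = - (ad m w $ i)" for i
  proof -
    have "e m \<one> (\<lambda>x. Ad_minus_id x w $ i) = (\<Sum>l\<in>UNIV. w $ l * e m \<one> (right_coeff i l))"
      unfolding eq tangent_add[OF frame_tangent s smooth_near_const]
      by (simp add: tangent_const[OF frame_tangent] tangent_sum[OF frame_tangent] smooth_near_mult smooth_near_const right_coeff_smooth
          tangent_cmult[OF frame_tangent])
    also have "\<dots> = - (ad m w $ i)"
      unfolding frame_right_coeff right_coeff_one ad_def
      by (simp add: sum_negf mult.commute if_distrib cong: if_cong)
    finally show ?thesis .
  qed
  have sA: "smooth_near A \<one> (\<lambda>x. Ad_minus_id x w $ i)" for i
    unfolding eq by (intro smooth_near_add s smooth_near_const)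
  have "T (ad m w) $ j = 0" for j
  proof -
    have "0 = e m \<one> (\<lambda>x. T (Ad_minus_id x w) $ j)" by (simp add: z tangent_const[OF frame_tangent])
    also have "\<dots> = e m \<one> (\<lambda>x. \<Sum>i\<in>UNIV. (T (axis i 1) $ j) * Ad_minus_id x w $ i)"
      by (subst T_sum) (simp add: mult.commute)
    also have "\<dots> = (\<Sum>i\<in>UNIV. (T (axis i 1) $ j) * e m \<one> (\<lambda>x. Ad_minus_id x w $ i))"
      by (simp add: tangent_sum[OF frame_tangent] tangent_cmult[OF frame_tangent sA] smooth_near_mult smooth_near_const sA)
    also have "\<dots> = - (T (ad m w) $ j)"
      by (subst (2) T_sum) (simp add: d sum_negf mult.commute)
    finally show ?thesis by simp
  qed
  then show ?thesis by (simp add: vec_eq_iff)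
qed

text \<open>The factors \<open>Ad_minus_id\<close> are exchanged for \<open>ad\<close> one at a
  time, from the left: with \<open>n\<close> factors already replaced, the leftmost remaining one is
  differentiated under the linear map formed by the factors before it. The bound
  \<open>n \<le> k\<close> in the induction makes the truncated subtraction \<open>k - n\<close>
  count the remaining factors.\<close>

lemma ad_nilpotent:
  assumes k: "lower_central_series G k = {\<one>}"
  shows "length ms = k \<Longrightarrow> foldr ad ms w = 0"
proof -
  have "length ms = n \<Longrightarrow> length xs = k - n \<Longrightarrow> n \<le> k \<Longrightarrow> foldr ad ms (foldr Ad_minus_id xs w) = 0"
    for n ms xs
  proof (induction n arbitrary: ms xs)
    case 0
    then show ?case using Ad_unipotent[OF k] by simp
  next
    case (Suc n)
    obtain ms' m where ms: "ms = ms' @ [m]" "length ms' = n"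
      using Suc.prems(1) by (metis length_Suc_conv_rev)
    have "foldr ad ms' (Ad_minus_id x (foldr Ad_minus_id xs w)) = 0" for x
      using Suc.IH[of ms' "x # xs"] ms Suc.prems by simp
    then show ?case using linear_ad_eq_0_if_Ad[OF linear_foldr_ad] ms(1) by simp
  qed
  from this[of ms k "[]"] show "length ms = k \<Longrightarrow> foldr ad ms w = 0" by simp
qed

section \<open>Vanishing structure constants make the group abelian\<close>

lemma constant_if_frame_vanishes:
  assumes conn: "connected (UNIV :: 'g set)"
    and f: "\<And>p. smooth_near A p f" and z: "\<And>p i. e i p f = 0"
  shows "f p = f q"
proof -
  have "\<exists>M. open M \<and> p \<in> M \<and> (\<forall>q\<in>M. f q = f p)" for p
  proof -
    have "v f = 0" if "v \<in> tangent_space A q" for q v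
      using frame_expansion[OF that] z by simp
    then show ?thesis
      using locally_constant_if_tangents_vanish[OF open_UNIV UNIV_I f, of p] by metis
  qed
  then have "f constant_on UNIV"
    using locally_constant_imp_constant[OF conn, of f]
    by (auto simp: eventually_at_topological)
  then show ?thesis by (metis UNIV_I constant_on_def)
qed

lemma abelian_if_structure_constants_vanish:
  assumes conn: "connected (UNIV :: 'g set)"
    and C: "\<And>i j k. structure_constant i j k = 0"
  shows "comm_group G"
proof -
  have a: "right_coeff j l x = (if j = l then 1 else 0)" for j l x
    using constant_if_frame_vanishes[OF conn right_coeff_smooth, of j l x "\<one>"]
    by (simp add: frame_right_coeff C right_coeff_one)
  have z1: "e l \<one> (\<lambda>y. h (commutator_map x y)) = 0" if h: "smooth_near A \<one> h" for l x h
  proof -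
    have "(\<Sum>l\<in>UNIV. right_coeff j l x * w $ l) = (\<Sum>l\<in>UNIV. if j = l then w $ l else 0)" for j w
      by (intro sum.cong) (auto simp: a)
    then have "Ad_minus_id x (axis l 1) = 0" by (simp add: Ad_minus_id_def vec_eq_iff)
    moreover have "(\<Sum>i\<in>UNIV. axis l 1 $ i * e i \<one> (\<lambda>y. h (commutator_map x y))) =
        (\<Sum>i\<in>UNIV. if i = l then e i \<one> (\<lambda>y. h (commutator_map x y)) else 0)"
      by (intro sum.cong) (auto simp: axis_def)
    ultimately show ?thesis
      using tangent_commutator_map[OF h, of "axis l 1" x] by simp
  qed
  have z: "e l y (\<lambda>y. h (commutator_map x y)) = 0" if h: "smooth_near A (commutator_map x y) h" for l x y h
  proof -
    let ?h = "\<lambda>z. h (inv\<^bsub>G\<^esub> x \<otimes> y \<otimes> x \<otimes> z \<otimes> inv\<^bsub>G\<^esub> y)"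
    \<comment> \<open>Moves the base point from \<open>y\<close> to the identity: after left
      translation the map is \<open>commutator_map x\<close> followed by fixed translations, so
      \<open>z1\<close> applies.\<close>
    have eq: "commutator_map x (y \<otimes> z) = inv\<^bsub>G\<^esub> x \<otimes> y \<otimes> x \<otimes> commutator_map x z \<otimes> inv\<^bsub>G\<^esub> y" for z
      by (simp add: commutator_map_def m_assoc inv_mult_group) (simp flip: m_assoc)
    have "e l y (\<lambda>y. h (commutator_map x y)) = e l \<one> (\<lambda>z. ?h (commutator_map x z))"
      using frame_left[of l y "\<one>" "\<lambda>y. h (commutator_map x y)"] by (simp add: eq)
    also have "\<dots> = 0"
      by (rule z1[of ?h], rule smooth_near_compose_map[of "\<one>" _ h])
        (use h in \<open>auto simp: commutator_map_def intro!: smooth_map_near_intros\<close>)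
    finally show ?thesis .
  qed
  have comm: "commutator_map x y = \<one>" for x y
  proof -
    \<comment> \<open>Open because the commutator map is locally constant, closed because it is
      continuous into a Hausdorff space, and nonempty because it contains the identity.\<close>
    let ?S = "{y. commutator_map x y = \<one>}"
    have "open ?S"
    proof (subst open_subopen, intro ballI)
      fix y assume y: "y \<in> ?S"
      obtain U c where U: "(U, c) \<in> A" "\<one> \<in> U" by (rule chart_at)
      obtain N where N: "open N" "y \<in> N" "commutator_map x ` N \<subseteq> U"
        by (rule smooth_map_near_nbhd[OF smooth_commutator_map chart_open(1)[OF U(1)], of x y])
          (use y U(2) in auto)
      have sc: "smooth_near A q (\<lambda>y. c (commutator_map x y))" if "q \<in> N" for q
        by (rule smooth_near_compose_map[OF smooth_commutator_map smooth_near_chart[OF U(1)]])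
          (use N that in auto)
      \<comment> \<open>Local constancy is available for real functions, so it is applied to each
        chart coordinate; the finitely many neighbourhoods are intersected afterwards.\<close>
      have "\<exists>M. open M \<and> y \<in> M \<and> (\<forall>q\<in>M. c (commutator_map x q) $ i = c (commutator_map x y) $ i)" for i
      proof -
        have s: "smooth_near A q (\<lambda>y. c (commutator_map x y) $ i)" if "q \<in> N" for q
          using smooth_near_inner[OF sc[OF that], of "axis i 1"] by (simp add: inner_axis)
        have "v (\<lambda>y. c (commutator_map x y) $ i) = 0" if "q \<in> N" "v \<in> tangent_space A q" for q v
        proof -
          have "smooth_near A (commutator_map x q) (\<lambda>y. c y $ i)"
            using smooth_near_inner[OF smooth_near_chart[OF U(1)], of "commutator_map x q" "axis i 1"] N(3) that(1)
            by (auto simp: inner_axis)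
          then show ?thesis using frame_expansion[OF that(2)] z[of x q "\<lambda>y. c y $ i"] by simp
        qed
        then show ?thesis
          using locally_constant_if_tangents_vanish[OF N(1,2) s] by metis
      qed
      then obtain M where M: "\<And>i. open (M i)" "\<And>i. y \<in> M i"
        "\<And>i q. q \<in> M i \<Longrightarrow> c (commutator_map x q) $ i = c (commutator_map x y) $ i" by metis
      let ?K = "N \<inter> (\<Inter>i. M i)"
      have "commutator_map x q = \<one>" if q: "q \<in> ?K" for q
      proof -
        have "c (commutator_map x q) = c \<one>" using M(3) q y by (auto simp: vec_eq_iff)
        moreover have "commutator_map x q \<in> U" using N(3) q by auto
        ultimately show ?thesis using chart_inverse[OF U(1)] U(2) by metis
      qed
      moreover have "open ?K" using N(1) M(1) by (intro open_Int open_INT) auto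
      ultimately show "\<exists>T. open T \<and> y \<in> T \<and> T \<subseteq> ?S" using N(2) M(2) by (intro exI[of _ ?K]) auto
    qed
    moreover have "closed ?S"
    proof -
      have "open (- ?S)"
      proof (subst open_subopen, intro ballI)
        fix y assume y: "y \<in> - ?S"
        then obtain N where N: "open N" "y \<in> N" "commutator_map x ` N \<subseteq> - {\<one>}"
          using smooth_map_near_nbhd[OF smooth_commutator_map, of "- {\<one>}" x y] by auto
        have "N \<subseteq> - ?S"
        proof
          fix q assume "q \<in> N"
          then have "commutator_map x q \<in> - {\<one>}" using N(3) by (meson image_subset_iff)
          then show "q \<in> - ?S" by simp
        qed
        then show "\<exists>T. open T \<and> y \<in> T \<and> T \<subseteq> - ?S" using N by blast
      qed
      then show ?thesis by (simp add: closed_def)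
    qed
    ultimately have "?S = {} \<or> ?S = UNIV" using conn connected_clopen[of "UNIV :: 'g set"] by auto
    then show ?thesis using commutator_map_one[of x] by blast
  qed
  have "x \<otimes> y = y \<otimes> x" for x y
  proof -
    have "x \<otimes> y = x \<otimes> (commutator_map x y \<otimes> y)" by (simp add: comm)
    also have "\<dots> = y \<otimes> x" by (simp add: commutator_map_def m_assoc) (simp flip: m_assoc)
    finally show ?thesis .
  qed
  then show ?thesis by (intro group_comm_groupI) auto
qed

section \<open>Connection coefficients of the frame\<close>

definition christoffel :: "'n \<Rightarrow> 'n \<Rightarrow> 'n \<Rightarrow> real" where
  "christoffel i j k = g \<one> (nabla (e i) (e j) \<one>) (e k \<one>)"

lemma nabla_tangent: "nabla (e i) (e j) p \<in> tangent_space A p"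
proof -
  have "smooth_vfield A (nabla (e i) (e j))"
    using levi_civita[unfolded levi_civita_connection_def affine_connection_def, THEN conjunct1, THEN conjunct1]
      frame_vfield by blast
  then show ?thesis unfolding smooth_vfield_def by blast
qed

text \<open>Metric compatibility, applied to the constant functions
  \<open>g (e j) (e k)\<close>.\<close>

lemma christoffel_skew: "christoffel i k j = - christoffel i j k"
proof -
  have "e i \<one> (\<lambda>q. g q (e j q) (e k q)) =
      g \<one> (nabla (e i) (e j) \<one>) (e k \<one>) + g \<one> (e j \<one>) (nabla (e i) (e k) \<one>)"
    using levi_civita[unfolded levi_civita_connection_def, THEN conjunct2, THEN conjunct2] frame_vfield by blast
  moreover have "e i \<one> (\<lambda>q. g q (e j q) (e k q)) = 0"
    unfolding frame_orthonormal by (rule tangent_const[OF frame_tangent])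
  ultimately show ?thesis
    using metric_commute[OF frame_tangent[of j "\<one>"] nabla_tangent[of i k]] by (simp add: christoffel_def)
qed

lemma structure_constant_christoffel: "structure_constant i j k = christoffel i j k - christoffel j i k"
proof -
  have eq: "(\<lambda>p f. nabla (e i) (e j) p f - nabla (e j) (e i) p f) = lie_bracket A (e i) (e j)"
    using levi_civita[unfolded levi_civita_connection_def, THEN conjunct2, THEN conjunct1] frame_vfield by blast
  have "structure_constant i j k = g \<one> (\<lambda>f. 1 * nabla (e i) (e j) \<one> f + (-1) * nabla (e j) (e i) \<one> f) (e k \<one>)"
    unfolding structure_constant_def by (simp flip: eq)
  also have "\<dots> = 1 * g \<one> (nabla (e i) (e j) \<one>) (e k \<one>) + (-1) * g \<one> (nabla (e j) (e i) \<one>) (e k \<one>)"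
    by (intro metric_combination nabla_tangent frame_tangent)
  finally show ?thesis by (simp add: christoffel_def)
qed

text \<open>By torsion-freeness and skewness the sum is minus the trace of \<open>ad m\<close>, and
  \<open>ad m\<close> is nilpotent.\<close>

lemma christoffel_trace:
  assumes nil: "nilpotent_group G"
  shows "(\<Sum>i\<in>UNIV. christoffel i m i) = 0"
proof -
  obtain k where k: "lower_central_series G k = {\<one>}" using nil unfolding nilpotent_group_def by blast
  have fr: "foldr ad (replicate n m) w = (ad m ^^ n) w" for n w by (induction n) auto
  have "(ad m ^^ k) w = 0" for w using ad_nilpotent[OF k, of "replicate k m" w] by (simp add: fr)
  from trace_nilpotent[OF linear_ad this]
  have "0 = (\<Sum>b\<in>Basis. ad m b \<bullet> b)" by simp
  also have "\<dots> = (\<Sum>i\<in>UNIV. ad m (axis i 1) \<bullet> axis i 1)"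
    unfolding Basis_vec_def by (subst sum.UNION_disjoint) (auto simp: axis_eq_axis)
  also have "\<dots> = (\<Sum>i\<in>UNIV. structure_constant m i i)"
  proof (intro sum.cong refl)
    fix i
    have "(\<Sum>j\<in>UNIV. structure_constant m j i * axis i 1 $ j) =
        (\<Sum>j\<in>UNIV. if j = i then structure_constant m i i else 0)"
      by (intro sum.cong) (auto simp: axis_def)
    then show "ad m (axis i 1) \<bullet> axis i 1 = structure_constant m i i"
      by (simp add: ad_def inner_axis)
  qed
  also have "\<dots> = - (\<Sum>i\<in>UNIV. christoffel i m i)"
  proof -
    have "christoffel m i i = 0" for i using christoffel_skew[of m i i] by simp
    then show ?thesis by (simp add: structure_constant_christoffel sum_negf)
  qed
  finally show ?thesis by simp
qed

section \<open>Central brackets and the cyclic sum\<close>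

lemma central_bracket:
  assumes nil: "nilpotent_group G" and conn: "connected (UNIV :: 'g set)" and nc: "\<not> comm_group G"
  obtains m w where "ad m w \<noteq> 0" "\<And>i. ad i (ad m w) = 0"
proof -
  define P where "P n \<longleftrightarrow> (\<forall>ms w. length ms = n \<longrightarrow> foldr ad ms w = 0)" for n
  \<comment> \<open>The least length at which all products of operators \<open>ad\<close> vanish. It
    is at least 2 because some \<open>ad i\<close> is nonzero, so a nonzero product of length
    \<open>N - 1\<close> still has a leading factor \<open>ad m\<close>, and every further
    \<open>ad i\<close> kills it.\<close>
  define N where "N = (LEAST n. P n)"
  have "\<exists>n. P n" using nil ad_nilpotent unfolding nilpotent_group_def P_def by blast
  then have PN: "P N" unfolding N_def by (rule LeastI_ex)
  obtain i j k where "structure_constant i j k \<noteq> 0"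
    using abelian_if_structure_constants_vanish[OF conn] nc by blast
  moreover have "(\<Sum>l\<in>UNIV. structure_constant i l k * axis j 1 $ l) =
      (\<Sum>l\<in>UNIV. if l = j then structure_constant i j k else 0)"
    by (intro sum.cong) (auto simp: axis_def)
  ultimately have "ad i (axis j 1) $ k \<noteq> 0" by (simp add: ad_def)
  then have ne: "ad i (axis j 1) \<noteq> 0" by (metis zero_index)
  have "\<not> P 0" using ne unfolding P_def by auto
  moreover have "\<not> P (Suc 0)"
  proof
    assume "P (Suc 0)"
    then have "foldr ad [i] (axis j 1) = 0" unfolding P_def by (metis length_Cons list.size(3))
    then show False using ne by simp
  qed
  ultimately obtain n where n: "N = Suc (Suc n)"
    using PN by (metis not0_implies_Suc)
  have "\<not> P (Suc n)" using not_less_Least[of "Suc n" P] n unfolding N_def by simp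
  then obtain ms w where ms: "length ms = Suc n" "foldr ad ms w \<noteq> 0" unfolding P_def by blast
  then obtain m ms' where ms': "ms = m # ms'" by (cases ms) auto
  have "ad i (foldr ad ms w) = 0" for i
    using PN[unfolded n P_def, rule_format, of "i # ms" w] ms(1) by simp
  then show thesis using that[of m "foldr ad ms' w"] ms(2) ms' by simp
qed

lemma structure_constant_skew: "structure_constant j i k = - structure_constant i j k"
  by (simp add: structure_constant_christoffel)

text \<open>Evaluated on \<open>m\<close>, \<open>w\<close> and the central vector
  \<open>z = ad m w\<close>, the cyclic sum loses its two terms with a bracket by \<open>z\<close>
  and leaves the squared norm of \<open>z\<close>.\<close>

lemma cyclic_structure_constants:
  assumes nil: "nilpotent_group G" and conn: "connected (UNIV :: 'g set)" and nc: "\<not> comm_group G"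
  obtains i j k where "structure_constant i j k + structure_constant j k i + structure_constant k i j \<noteq> 0"
proof (rule ccontr)
  let ?C = structure_constant
  assume "\<not> thesis"
  then have T: "?C i j k + ?C j k i + ?C k i j = 0" for i j k using that by blast
  obtain m w where w: "ad m w \<noteq> 0" and c: "\<And>i. ad i (ad m w) = 0"
    using central_bracket[OF assms] by blast
  define z where "z = ad m w"
  have cz: "(\<Sum>k\<in>UNIV. ?C i k l * z $ k) = 0" for i l
    using c[of i] unfolding z_def[symmetric] ad_def[of i] by (simp add: vec_eq_iff)
  have "(\<Sum>k\<in>UNIV. ?C m j k * z $ k) = 0" for j
  proof -
    have "?C m j k = ?C m k j - ?C j k m" for k
      using T[of m j k] structure_constant_skew[of k m j] by linarith
    then show ?thesis using cz by (simp add: left_diff_distrib sum_subtractf)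
  qed
  then have "(\<Sum>j\<in>UNIV. w $ j * (\<Sum>k\<in>UNIV. ?C m j k * z $ k)) = 0" by simp
  moreover have "(\<Sum>j\<in>UNIV. w $ j * (\<Sum>k\<in>UNIV. ?C m j k * z $ k)) = z \<bullet> z"
  proof -
    have "z \<bullet> z = (\<Sum>k\<in>UNIV. (\<Sum>j\<in>UNIV. ?C m j k * w $ j) * z $ k)"
      unfolding inner_vec_def by (simp add: z_def ad_def)
    also have "\<dots> = (\<Sum>j\<in>UNIV. w $ j * (\<Sum>k\<in>UNIV. ?C m j k * z $ k))"
      unfolding sum_distrib_left sum_distrib_right by (subst sum.swap) (simp add: mult_ac)
    finally show ?thesis by simp
  qed
  ultimately show False using w by (simp add: z_def)
qed

end

section \<open>Clifford multiplication by 3-forms\<close>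

text \<open>Turns the sum over \<open>j < k\<close> in the spin connection into half of a full
  double sum. There skewness of the connection coefficients and anticommutation of the generators
  make the summand symmetric.\<close>

lemma sum_symmetric_less:
  fixes F :: "'n::{finite, linorder} \<Rightarrow> 'n \<Rightarrow> 'w::real_vector"
  assumes "\<And>j k. F k j = F j k" "\<And>j. F j j = 0"
  shows "(\<Sum>j\<in>UNIV. \<Sum>k\<in>UNIV. F j k) = 2 *\<^sub>R (\<Sum>(j, k)\<in>{(j, k). j < k}. F j k)"
proof -
  let ?L = "{(j, k). j < (k :: 'n)}" and ?U = "{(j, k). k < (j :: 'n)}" and ?D = "{(j, k). j = (k :: 'n)}"
  have "(\<Sum>j\<in>UNIV. \<Sum>k\<in>UNIV. F j k) = (\<Sum>(j, k)\<in>UNIV. F j k)"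
    by (simp add: sum.cartesian_product)
  also have "UNIV = (?L \<union> ?U) \<union> ?D" by auto
  also have "(\<Sum>(j, k)\<in>(?L \<union> ?U) \<union> ?D. F j k) = (\<Sum>(j, k)\<in>?L \<union> ?U. F j k) + (\<Sum>(j, k)\<in>?D. F j k)"
    by (rule sum.union_disjoint) auto
  also have "(\<Sum>(j, k)\<in>?D. F j k) = 0" by (rule sum.neutral) (auto simp: assms)
  also have "(\<Sum>(j, k)\<in>?L \<union> ?U. F j k) = (\<Sum>(j, k)\<in>?L. F j k) + (\<Sum>(j, k)\<in>?U. F j k)"
    by (rule sum.union_disjoint) auto
  also have "(\<Sum>(j, k)\<in>?U. F j k) = (\<Sum>(j, k)\<in>?L. F j k)"
    by (rule sum.reindex_bij_witness[of _ prod.swap prod.swap]) (auto simp: assms(1))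
  finally show ?thesis by (simp add: scaleR_2)
qed

lemma clifford_relation:
  assumes "clifford_representation \<rho>"
  shows "linear (\<rho> (cl_gen i))"
    and "\<rho> (cl_gen i) (\<rho> (cl_gen i) w) = - w"
    and "i \<noteq> j \<Longrightarrow> \<rho> (cl_gen j) (\<rho> (cl_gen i) w) = - \<rho> (cl_gen i) (\<rho> (cl_gen j) w)"
    and "\<rho> (cl_mult (cl_gen i) (cl_gen j)) w = \<rho> (cl_gen i) (\<rho> (cl_gen j) w)"
proof -
  have lin: "linear (\<lambda>a. \<rho> a w)" and mult: "\<rho> (cl_mult a b) w = \<rho> a (\<rho> b w)" for a b w
    using assms unfolding clifford_representation_def by auto
  have sg: "cl_sign {i} {j} = (if j \<le> i then -1 else 1)" for i j :: 'a
  proof -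
    have "{(s, t). s \<in> {i} \<and> t \<in> {j} \<and> t \<le> s} = (if j \<le> i then {(i, j)} else {})" by auto
    then show ?thesis unfolding cl_sign_def by simp
  qed
  show "linear (\<rho> (cl_gen i))" using assms unfolding clifford_representation_def by blast
  show "\<rho> (cl_mult (cl_gen i) (cl_gen j)) w = \<rho> (cl_gen i) (\<rho> (cl_gen j) w)" by (rule mult)
  have "cl_mult (cl_gen i) (cl_gen i) = (-1) *\<^sub>R cl_one"
    by (simp add: cl_gen_def cl_one_def cl_mult_basis sg)
  then have "\<rho> (cl_gen i) (\<rho> (cl_gen i) w) = (-1) *\<^sub>R \<rho> cl_one w"
    using mult linear_scale[OF lin] by metis
  then show "\<rho> (cl_gen i) (\<rho> (cl_gen i) w) = - w"
    using assms unfolding clifford_representation_def by simp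
  show "\<rho> (cl_gen j) (\<rho> (cl_gen i) w) = - \<rho> (cl_gen i) (\<rho> (cl_gen j) w)" if "i \<noteq> j"
  proof -
    have "cl_mult (cl_gen j) (cl_gen i) = (-1) *\<^sub>R cl_mult (cl_gen i) (cl_gen j)"
      using that by (auto simp: cl_gen_def cl_mult_basis sg Un_commute)
    then have "\<rho> (cl_gen j) (\<rho> (cl_gen i) w) = (-1) *\<^sub>R \<rho> (cl_gen i) (\<rho> (cl_gen j) w)"
      using mult linear_scale[OF lin] by metis
    then show ?thesis by simp
  qed
qed

lemma clifford_three_form_injective:
  fixes a b c d :: "'w::real_vector \<Rightarrow> 'w" and p q r s :: real
  assumes lin: "linear a" "linear b" "linear c" "linear d"
    and sq: "\<And>x. a (a x) = - x" "\<And>x. b (b x) = - x" "\<And>x. c (c x) = - x" "\<And>x. d (d x) = - x"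
    and anti: "\<And>x. b (a x) = - a (b x)" "\<And>x. c (a x) = - a (c x)" "\<And>x. d (a x) = - a (d x)"
      "\<And>x. c (b x) = - b (c x)" "\<And>x. d (b x) = - b (d x)" "\<And>x. d (c x) = - c (d x)"
    and z: "p *\<^sub>R b (c (d w)) + q *\<^sub>R a (c (d w)) + r *\<^sub>R a (b (d w)) + s *\<^sub>R a (b (c w)) = 0"
    and w: "w \<noteq> 0"
  shows "p = 0" "q = 0" "r = 0" "s = 0"
proof -
  note l = lin[THEN linear_add] lin[THEN linear_neg] lin[THEN linear_diff] lin[THEN linear_scale]
  \<comment> \<open>\<open>x\<close> is the volume element applied to \<open>w\<close>. The volume
    element squares to 1 in dimension 4, hence \<open>x\<close> is nonzero.\<close>
  define x where "x = a (b (c (d w)))"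
  have "a (b (c (d x))) = w" unfolding x_def by (simp add: l sq anti)
  then have x: "x \<noteq> 0" using w lin linear_0 by metis
  \<comment> \<open>Clifford multiplication by a vector whose signs are chosen so that
    \<open>v x\<close> is the left-hand side of \<open>z\<close>. It squares to minus its squared
    length, so it can kill a nonzero \<open>x\<close> only if all coefficients vanish.\<close>
  define v where "v = (\<lambda>x. s *\<^sub>R d x - r *\<^sub>R c x + q *\<^sub>R b x - p *\<^sub>R a x)"
  have "v x = 0" using z unfolding x_def v_def by (simp add: l sq anti algebra_simps)
  then have "v (v x) = 0" unfolding v_def by (simp add: lin[THEN linear_0])
  moreover have "v (v x) = - (p^2 + q^2 + r^2 + s^2) *\<^sub>R x"
    unfolding v_def by (simp add: l sq anti algebra_simps power2_eq_square)
  ultimately have "p^2 + q^2 + r^2 + s^2 = 0" using x by simp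
  then show "p = 0" "q = 0" "r = 0" "s = 0"
    by (smt (verit) zero_le_power2 zero_eq_power2)+
qed

text \<open>Terms with a repeated index reduce to multiples of single \<open>E m w\<close>, whose
  coefficients are multiples of the traces in \<open>tr\<close>. For three distinct indices the six
  permutations combine to twice the cyclic sum, and \<open>clifford_three_form_injective\<close>
  applies.\<close>

lemma dirac_kernel_cyclic:
  fixes \<omega> :: "4 \<Rightarrow> 4 \<Rightarrow> 4 \<Rightarrow> real" and E :: "4 \<Rightarrow> 'w::real_inner \<Rightarrow> 'w"
  assumes lin: "\<And>i. linear (E i)"
    and sq: "\<And>i x. E i (E i x) = - x"
    and anti: "\<And>i j x. i \<noteq> j \<Longrightarrow> E j (E i x) = - E i (E j x)"
    and skew: "\<And>i j k. \<omega> i k j = - \<omega> i j k"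
    and tr: "\<And>m. (\<Sum>i\<in>UNIV. \<omega> i m i) = 0"
    and z: "(\<Sum>i\<in>UNIV. \<Sum>j\<in>UNIV. \<Sum>k\<in>UNIV. \<omega> i j k *\<^sub>R E i (E j (E k w))) = 0"
    and w: "w \<noteq> 0"
  shows "\<omega> i j k + \<omega> j k i + \<omega> k i j = 0"
proof -
  let ?S = "\<lambda>i j k. \<omega> i j k + \<omega> j k i + \<omega> k i j"
  have d: "\<omega> i j j = 0" for i j using skew[of i j j] by simp
  note sk = skew[of _ 2 1] skew[of _ 3 1] skew[of _ 4 1] skew[of _ 3 2] skew[of _ 4 2] skew[of _ 4 3]
  note an = anti[of 1 2, simplified] anti[of 1 3, simplified] anti[of 1 4, simplified]
    anti[of 2 3, simplified] anti[of 2 4, simplified] anti[of 3 4, simplified]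
  note l = lin[THEN linear_add] lin[THEN linear_neg] lin[THEN linear_diff] lin[THEN linear_scale]
  \<comment> \<open>With \<open>sk\<close> the last two indices are put in the order of the numerals
    1, 2, 3, 4; each trace condition then eliminates one of the remaining coefficients.\<close>
  have t1: "\<omega> 4 1 4 = - \<omega> 2 1 2 - \<omega> 3 1 3" using tr[of 1] by (simp add: sum_4 d)
  have t2: "\<omega> 4 2 4 = \<omega> 1 1 2 - \<omega> 3 2 3" using tr[of 2] by (simp add: sum_4 d sk)
  have t3: "\<omega> 4 3 4 = \<omega> 1 1 3 + \<omega> 2 2 3" using tr[of 3] by (simp add: sum_4 d sk)
  have t4: "\<omega> 3 3 4 = - \<omega> 1 1 4 - \<omega> 2 2 4" using tr[of 4] by (simp add: sum_4 d sk)
  \<comment> \<open>The inner product with an arbitrary \<open>u\<close> reduces the vector identity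
    to one between real expressions.\<close>
  have "(\<Sum>i\<in>UNIV. \<Sum>j\<in>UNIV. \<Sum>k\<in>UNIV. \<omega> i j k *\<^sub>R E i (E j (E k w))) \<bullet> u =
     ((2 * ?S 2 3 4) *\<^sub>R E 2 (E 3 (E 4 w)) + (2 * ?S 1 3 4) *\<^sub>R E 1 (E 3 (E 4 w)) +
      (2 * ?S 1 2 4) *\<^sub>R E 1 (E 2 (E 4 w)) + (2 * ?S 1 2 3) *\<^sub>R E 1 (E 2 (E 3 w))) \<bullet> u" for u
    by (simp add: sum_4 d sk sq an l t1 t2 t3 t4 inner_simps algebra_simps)
  then have "(\<Sum>i\<in>UNIV. \<Sum>j\<in>UNIV. \<Sum>k\<in>UNIV. \<omega> i j k *\<^sub>R E i (E j (E k w))) =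
      (2 * ?S 2 3 4) *\<^sub>R E 2 (E 3 (E 4 w)) + (2 * ?S 1 3 4) *\<^sub>R E 1 (E 3 (E 4 w)) +
      (2 * ?S 1 2 4) *\<^sub>R E 1 (E 2 (E 4 w)) + (2 * ?S 1 2 3) *\<^sub>R E 1 (E 2 (E 3 w))"
    using vector_eq_rdot by blast
  from clifford_three_form_injective[OF lin[of 1] lin[of 2] lin[of 3] lin[of 4] sq sq sq sq an,
      OF trans[OF this[symmetric] z] w]
  have S: "?S 2 3 4 = 0" "?S 1 3 4 = 0" "?S 1 2 4 = 0" "?S 1 2 3 = 0" by simp_all
  \<comment> \<open>The cyclic sum is alternating, so the four values with distinct indices
    determine all others.\<close>
  have "\<forall>i j k. ?S i j k = 0"
    using S unfolding forall_4 d sk by (intro conjI; linarith)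
  then show ?thesis by blast
qed

section \<open>Harmonic spinors\<close>

theorem theorem6p1:
  fixes G :: "'g::{t2_space, second_countable_topology} monoid"
    and A :: "('g, real ^ 4) atlas"
    and \<Gamma> :: "'g set"
    and g :: "'g \<Rightarrow> 'g tangent \<Rightarrow> 'g tangent \<Rightarrow> real"
    and nabla :: "'g vfield \<Rightarrow> 'g vfield \<Rightarrow> 'g vfield"
    and e :: "4 \<Rightarrow> 'g vfield"
    and \<rho> :: "4 clifford \<Rightarrow> 'w::euclidean_space \<Rightarrow> 'w"
  assumes "lie_group G A"
    and "connected (UNIV :: 'g set)"
    and "simply_connected (UNIV :: 'g set)"
    and "\<not> comm_group G"
    and "nilpotent_group G"
    and "subgroup \<Gamma> G" and "discrete \<Gamma>"
    and "riemannian_metric A g" and "left_invariant_metric G A g"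
    and "levi_civita_connection A g nabla"
    and "left_invariant_orthonormal_frame G A g e"
    and "irreducible_clifford_representation \<rho>"
  shows "\<not> (\<exists>\<phi> :: 'g \<Rightarrow> 'w. spinor_on_quotient G A \<Gamma> \<phi> \<and> left_invariant_spinor \<phi> \<and>
           \<phi> \<noteq> (\<lambda>x. 0) \<and> harmonic_spinor g nabla e \<rho> \<phi>)"
proof
  interpret lie_group_frame A G g nabla e
    using assms by unfold_locales (auto simp: lie_group_def)
  assume "\<exists>\<phi> :: 'g \<Rightarrow> 'w. spinor_on_quotient G A \<Gamma> \<phi> \<and> left_invariant_spinor \<phi> \<and>
           \<phi> \<noteq> (\<lambda>x. 0) \<and> harmonic_spinor g nabla e \<rho> \<phi>"
  then obtain w where w: "w \<noteq> 0" and h: "harmonic_spinor g nabla e \<rho> (\<lambda>x. w)"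
    unfolding left_invariant_spinor_def by (metis ext)
  have rep: "clifford_representation \<rho>"
    using assms(12) unfolding irreducible_clifford_representation_def by blast
  note cl = clifford_relation[OF rep]
  define E where "E i = \<rho> (cl_gen i)" for i
  note E = cl[folded E_def]
  let ?F = "\<lambda>i j k. christoffel i j k *\<^sub>R E j (E k w)"
  have sym: "?F i k j = ?F i j k" for i j k
    using E(3)[of j k w] christoffel_skew[of i k j] by (cases "j = k") auto
  have diag: "?F i j j = 0" for i j
    using christoffel_skew[of i j j] by simp
  have half: "(\<Sum>(j, k)\<in>{(j, k). j < k}. ?F i j k) = (1 / 2) *\<^sub>R (\<Sum>j\<in>UNIV. \<Sum>k\<in>UNIV. ?F i j k)" for i
    using sum_symmetric_less[of "?F i", OF sym diag] by simp
  \<comment> \<open>Evaluation at the identity, where the connection coefficients are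
    \<open>christoffel\<close>. The derivative term drops out because the spinor is
    constant.\<close>
  have "0 = dirac_operator g nabla e \<rho> (\<lambda>x. w) \<one>\<^bsub>G\<^esub>"
    using h unfolding harmonic_spinor_def by simp
  also have "\<dots> = (\<Sum>i\<in>UNIV. E i ((1 / 2) *\<^sub>R (\<Sum>(j, k)\<in>{(j, k). j < k}. ?F i j k)))"
    unfolding dirac_operator_def spin_connection_def E(4)
    by (simp add: dir_deriv_def tangent_const[OF frame_tangent] christoffel_def E_def)
  \<comment> \<open>One factor 1/2 comes from the spin connection, the other from passing to the
    full double sum.\<close>
  also have "\<dots> = (1 / 4) *\<^sub>R (\<Sum>i\<in>UNIV. \<Sum>j\<in>UNIV. \<Sum>k\<in>UNIV. christoffel i j k *\<^sub>R E i (E j (E k w)))"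
    unfolding half by (simp add: linear_sum[OF E(1)] linear_scale[OF E(1)] scaleR_sum_right)
  finally have z: "(\<Sum>i\<in>UNIV. \<Sum>j\<in>UNIV. \<Sum>k\<in>UNIV. christoffel i j k *\<^sub>R E i (E j (E k w))) = 0"
    by simp
  have cyc: "christoffel i j k + christoffel j k i + christoffel k i j = 0" for i j k
    by (rule dirac_kernel_cyclic[OF E(1,2,3) christoffel_skew christoffel_trace[OF assms(5)] z w])
  obtain i j k where "structure_constant i j k + structure_constant j k i + structure_constant k i j \<noteq> 0"
    by (rule cyclic_structure_constants[OF assms(5,2,4)])
  \<comment> \<open>By torsion-freeness and skewness this sum is twice the cyclic sum of the
    connection coefficients.\<close>
  moreover have "structure_constant i j k + structure_constant j k i + structure_constant k i j = 0"
    unfolding structure_constant_christoffel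
    using cyc[of i j k] christoffel_skew[of i k j] christoffel_skew[of j i k] christoffel_skew[of k j i] by linarith
  ultimately show False by blast
qed

end
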